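(* Consider the structured linear-concave-affine isoperimetric control problem described in the context, with value function $V(B)=\sup\{J(u):u\in\mathcal U,\ \mathcal C(u)=B\}$ and $\operatorname{dom}V=\mathcal C(\mathcal U)$. Let $B_0\in\operatorname{int}(\operatorname{dom}V)$ (equivalently, there exist admissible controls with constraint levels strictly below and strictly above $B_0$), and let $u^*$ be optimal for $V(B_0)$, i.e. $u^*\in\mathcal U$, $\mathcal C(u^* )=B_0$, $J(u^* )=V(B_0)$. Then: (a) $u^*$ is a normal extremal: in the Fritz–John form of the necessary conditions there is no admissible multiplier with vanishing payoff coefficient (that is, every Fritz–John multiplier pair $(\lambda_0,\mu)$ for $u^*$ has $\lambda_0>0$), so the payoff coefficient may be normalized to $\lambda_0=1$; (b) every constant isoperimetric Pontryagin multiplier $\mu$ associated with $u^*$ is a saddle-point multiplier and lies in $\mathcal D(B_0)$; (c) conversely, every $\bar\mu\in\mathcal D(B_0)$ is the isoperimetric Pontryagin multiplier of some optimal control at level $B_0$.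
   Context: Structured class. Fix $T>0$, $x_0\in\mathbb R^n$, and a nonempty, compact, convex set $U\subset\mathbb R^m$. Let $\mathcal U=\{u\in L^\infty(0,T;\mathbb R^m): u(t)\in U\text{ for a.e. }t\}$. For $u\in\mathcal U$ let $x_u\in W^{1,\infty}(0,T;\mathbb R^n)$ be the unique solution of $\dot x(t)=A(t)x(t)+B(t)u(t)$, $x(0)=x_0$, where $A,B$ are measurable and bounded matrix functions of sizes $n\times n$ and $n\times m$. The payoff is $J(u)=\int_0^T f(t,x_u(t),u(t))\,dt+\phi(x_u(T))$, where: $f:[0,T]\times\mathbb R^n\times\mathbb R^m\to\mathbb R$ is measurable in $t$ for each $(x,u)$; $f(t,\cdot,\cdot)$ is $C^1$ for a.e. $t$ and concave (and upper semicontinuous); $|f(t,x,u)|\le c(1+\|x\|^2+\|u\|^2)$ on $[0,T]\times\mathbb R^n\times U$; $\phi\in C^1(\mathbb R^n)$ is concave (and upper semicontinuous) with $|\phi(x)|\le c(1+\|x\|^2)$, for some $c>0$. Moreover $J$ is assumed weak-$*$ upper semicontinuous on $\mathcal U$ (weak-$*$ topology of $L^\infty=(L^1)^*$). The constraint functional is $\mathcal C(u)=\int_0^T h(t,x_u(t),u(t))\,dt$ with $h(t,x,u)=a(t)^\top x+b(t)^\top u+c_0(t)$, where $a,b,c_0$ are measurable and bounded. Fritz–John multiplier pair for $u^*$ at level $B_0$: a pair $(\lambda_0,\mu)\in[0,\infty)\times\mathbb R$, $(\lambda_0,\mu)\ne(0,0)$, such that $u^*$ maximizes $u\mapsto\lambda_0J(u)+\mu(\mathcal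 C(u)-B_0)$ over $\mathcal U$. Isoperimetric Pontryagin multiplier associated with an optimal control $u^*$ (with $x^*=x_{u^*}$): a constant $\mu\in\mathbb R$ for which there is $\lambda\in W^{1,1}(0,T;\mathbb R^n)$ such that, with $\widetilde H(t,x,u,\lambda,\mu)=f(t,x,u)+\lambda^\top(A(t)x+B(t)u)+\mu\,h(t,x,u)$, for a.e. $t$: $\dot\lambda(t)=-\nabla_x\widetilde H(t,x^*(t),u^*(t),\lambda(t),\mu)$ and $\widetilde H(t,x^*(t),u^*(t),\lambda(t),\mu)=\max_{v\in U}\widetilde H(t,x^*(t),v,\lambda(t),\mu)$, and $\lambda(T)=\nabla\phi(x^*(T))$. Saddle-point multiplier: $(u^*,\mu)$ is a saddle point of $L(u,\mu')=J(u)+\mu'(\mathcal C(u)-B_0)$ on $\mathcal U\times\mathbb R$, i.e. $L(u,\mu)\le L(u^*,\mu)\le L(u^*,\mu')$ for all $u\in\mathcal U$, $\mu'\in\mathbb R$. Dual-optimal multipliers: $\ell(\mu)=\sup_{u\in\mathcal U}\{J(u)+\mu\,\mathcal C(u)\}$, $\mathcal D(B_0)=\operatorname{arg\,min}_{\mu\in\mathbb R}\{\ell(\mu)-\mu B_0\}$. *)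

theory Defs
  imports "HOL-Analysis.Analysis"
begin

section \<open>Analytic preliminaries\<close>

definition C1_fun :: "('a::real_inner \<Rightarrow> real) \<Rightarrow> bool" where
  "C1_fun F \<longleftrightarrow> (\<exists>G. (\<forall>z. GDERIV F z :> G z) \<and> continuous_on UNIV G)"

definition usc_in :: "'a topology \<Rightarrow> ('a \<Rightarrow> real) \<Rightarrow> bool" where
  "usc_in X F \<longleftrightarrow> (\<forall>r. openin X {x \<in> topspace X. F x < r})"

text \<open>Members of \<open>L\<^sup>\<infinity>(0,T)\<close> are handled through representatives \<open>real \<Rightarrow> _\<close>, whose values
  outside \<open>{0..T}\<close> are irrelevant.\<close>

definition Linf :: "real \<Rightarrow> (real \<Rightarrow> 'a::euclidean_space) set" where
  "Linf T = {u \<in> borel_measurable (lebesgue_on {0..T}).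
     \<exists>K. AE t in lebesgue_on {0..T}. norm (u t) \<le> K}"

text \<open>The weak-* topology of \<open>L\<^sup>\<infinity> = (L\<^sup>1)\<^sup>*\<close>, pulled back to representatives: the coarsest topology
  on \<open>Linf T\<close> making \<open>u \<mapsto> \<integral> g \<bullet> u\<close> continuous for every \<open>g\<close> in \<open>L\<^sup>1\<close>. A functional that
  respects almost everywhere equality is upper semicontinuous for it iff the induced functional on
  equivalence classes is.\<close>

definition weak_star :: "real \<Rightarrow> (real \<Rightarrow> 'a::euclidean_space) topology" where
  "weak_star T = topology_generated_by
     {{u \<in> Linf T. integral\<^sup>L (lebesgue_on {0..T}) (\<lambda>t. g t \<bullet> u t) \<in> S} | g S.
        integrable (lebesgue_on {0..T}) g \<and> open S}"

text \<open>\<open>x\<close> is the absolutely continuous representative of an element of \<open>W\<^sup>1\<^sup>,\<^sup>1(0,T)\<close> with weak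
  derivative \<open>dx\<close>; it lies in \<open>W\<^sup>1\<^sup>,\<^sup>\<infinity>\<close> iff moreover \<open>dx \<in> Linf T\<close>.\<close>

definition W11_deriv :: "real \<Rightarrow> (real \<Rightarrow> 'a::euclidean_space) \<Rightarrow> (real \<Rightarrow> 'a) \<Rightarrow> bool" where
  "W11_deriv T x dx \<longleftrightarrow> integrable (lebesgue_on {0..T}) dx \<and>
     (\<forall>t\<in>{0..T}. x t = x 0 + integral\<^sup>L (lebesgue_on {0..t}) dx)"


section \<open>The isoperimetric control problem\<close>

text \<open>The dynamics are \<open>x' = A x + B u\<close>; the constraint integrand is
  \<open>h(t,x,u) = con_a(t) \<bullet> x + con_b(t) \<bullet> u + con_c(t)\<close>.\<close>

record ('n::finite, 'm::finite) control_problem =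
  horizon :: real
  x_init :: "real^'n"
  ctrl_set :: "(real^'m) set"
  mat_A :: "real \<Rightarrow> real^'n^'n"
  mat_B :: "real \<Rightarrow> real^'m^'n"
  run_payoff :: "real \<Rightarrow> real^'n \<Rightarrow> real^'m \<Rightarrow> real"
  end_payoff :: "real^'n \<Rightarrow> real"
  con_a :: "real \<Rightarrow> real^'n"
  con_b :: "real \<Rightarrow> real^'m"
  con_c :: "real \<Rightarrow> real"

abbreviation time_measure :: "('n::finite, 'm::finite) control_problem \<Rightarrow> real measure" where
  "time_measure P \<equiv> lebesgue_on {0..horizon P}"

definition controls :: "('n::finite, 'm::finite) control_problem \<Rightarrow> (real \<Rightarrow> real^'m) set" where
  "controls P = {u \<in> Linf (horizon P). AE t in time_measure P. u t \<in> ctrl_set P}"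

definition is_trajectory ::
  "('n::finite, 'm::finite) control_problem \<Rightarrow> (real \<Rightarrow> real^'m) \<Rightarrow> (real \<Rightarrow> real^'n) \<Rightarrow> bool" where
  "is_trajectory P u x \<longleftrightarrow> x 0 = x_init P \<and>
     (\<exists>dx \<in> Linf (horizon P). W11_deriv (horizon P) x dx \<and>
        (AE t in time_measure P. dx t = mat_A P t *v x t + mat_B P t *v u t))"

text \<open>For an admissible control the trajectory exists and is unique on \<open>{0..horizon P}\<close>; everything
  below depends on it only through its values there.\<close>

definition state ::
  "('n::finite, 'm::finite) control_problem \<Rightarrow> (real \<Rightarrow> real^'m) \<Rightarrow> real \<Rightarrow> real^'n" where
  "state P u = (SOME x. is_trajectory P u x)"

definition payoff :: "('n::finite, 'm::finite) control_problem \<Rightarrow> (real \<Rightarrow> real^'m) \<Rightarrow> real" where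
  "payoff P u = integral\<^sup>L (time_measure P) (\<lambda>t. run_payoff P t (state P u t) (u t))
     + end_payoff P (state P u (horizon P))"

definition con_h ::
  "('n::finite, 'm::finite) control_problem \<Rightarrow> real \<Rightarrow> real^'n \<Rightarrow> real^'m \<Rightarrow> real" where
  "con_h P t x u = con_a P t \<bullet> x + con_b P t \<bullet> u + con_c P t"

definition constraint :: "('n::finite, 'm::finite) control_problem \<Rightarrow> (real \<Rightarrow> real^'m) \<Rightarrow> real" where
  "constraint P u = integral\<^sup>L (time_measure P) (\<lambda>t. con_h P t (state P u t) (u t))"

definition meas_bdd :: "real \<Rightarrow> (real \<Rightarrow> 'a::euclidean_space) \<Rightarrow> bool" where
  "meas_bdd T F \<longleftrightarrow> F \<in> borel_measurable (lebesgue_on {0..T}) \<and> bounded (F ` {0..T})"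

definition structured_problem :: "('n::finite, 'm::finite) control_problem \<Rightarrow> bool" where
  "structured_problem P \<longleftrightarrow>
     horizon P > 0 \<and>
     ctrl_set P \<noteq> {} \<and> compact (ctrl_set P) \<and> convex (ctrl_set P) \<and>
     meas_bdd (horizon P) (mat_A P) \<and> meas_bdd (horizon P) (mat_B P) \<and>
     meas_bdd (horizon P) (con_a P) \<and> meas_bdd (horizon P) (con_b P) \<and>
     meas_bdd (horizon P) (con_c P) \<and>
     (\<forall>x u. (\<lambda>t. run_payoff P t x u) \<in> borel_measurable (time_measure P)) \<and>
     (AE t in time_measure P.
        C1_fun (\<lambda>(x, u). run_payoff P t x u) \<and>
        concave_on UNIV (\<lambda>(x, u). run_payoff P t x u) \<and>
        usc_in euclidean (\<lambda>(x, u). run_payoff P t x u)) \<and>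
     C1_fun (end_payoff P) \<and> concave_on UNIV (end_payoff P) \<and> usc_in euclidean (end_payoff P) \<and>
     (\<exists>c>0.
        (\<forall>t\<in>{0..horizon P}. \<forall>x. \<forall>u\<in>ctrl_set P.
           \<bar>run_payoff P t x u\<bar> \<le> c * (1 + (norm x)\<^sup>2 + (norm u)\<^sup>2)) \<and>
        (\<forall>x. \<bar>end_payoff P x\<bar> \<le> c * (1 + (norm x)\<^sup>2))) \<and>
     usc_in (subtopology (weak_star (horizon P)) (controls P)) (payoff P)"


section \<open>Value function, optimality and multipliers\<close>

definition value_fun :: "('n::finite, 'm::finite) control_problem \<Rightarrow> real \<Rightarrow> ereal" where
  "value_fun P b = (SUP u \<in> {u \<in> controls P. constraint P u = b}. ereal (payoff P u))"

definition value_dom :: "('n::finite, 'm::finite) control_problem \<Rightarrow> real set" where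
  "value_dom P = {b. value_fun P b > -\<infinity>}"

lemma value_dom_eq: "value_dom P = constraint P ` controls P"
  by (auto simp: value_dom_def value_fun_def less_SUP_iff)

definition optimal_control ::
  "('n::finite, 'm::finite) control_problem \<Rightarrow> real \<Rightarrow> (real \<Rightarrow> real^'m) \<Rightarrow> bool" where
  "optimal_control P B0 u \<longleftrightarrow>
     u \<in> controls P \<and> constraint P u = B0 \<and> ereal (payoff P u) = value_fun P B0"

definition fritz_john ::
  "('n::finite, 'm::finite) control_problem \<Rightarrow> real \<Rightarrow> (real \<Rightarrow> real^'m) \<Rightarrow> real \<Rightarrow> real \<Rightarrow> bool" where
  "fritz_john P B0 u l0 \<mu> \<longleftrightarrow> l0 \<ge> 0 \<and> (l0, \<mu>) \<noteq> (0, 0) \<and>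
     is_arg_max (\<lambda>v. l0 * payoff P v + \<mu> * (constraint P v - B0)) (\<lambda>v. v \<in> controls P) u"

definition hamiltonian ::
  "('n::finite, 'm::finite) control_problem \<Rightarrow>
    real \<Rightarrow> real^'n \<Rightarrow> real^'m \<Rightarrow> real^'n \<Rightarrow> real \<Rightarrow> real" where
  "hamiltonian P t x u p \<mu> =
     run_payoff P t x u + p \<bullet> (mat_A P t *v x + mat_B P t *v u) + \<mu> * con_h P t x u"

definition pontryagin_multiplier ::
  "('n::finite, 'm::finite) control_problem \<Rightarrow> (real \<Rightarrow> real^'m) \<Rightarrow> real \<Rightarrow> bool" where
  "pontryagin_multiplier P u \<mu> \<longleftrightarrow>
     (\<exists>p dp. W11_deriv (horizon P) p dp \<and>
        (AE t in time_measure P.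
           (GDERIV (\<lambda>x. hamiltonian P t x (u t) (p t) \<mu>) (state P u t) :> - dp t) \<and>
           is_arg_max (\<lambda>v. hamiltonian P t (state P u t) v (p t) \<mu>) (\<lambda>v. v \<in> ctrl_set P) (u t)) \<and>
        (GDERIV (end_payoff P) (state P u (horizon P)) :> p (horizon P)))"

definition lagrangian ::
  "('n::finite, 'm::finite) control_problem \<Rightarrow> real \<Rightarrow> (real \<Rightarrow> real^'m) \<Rightarrow> real \<Rightarrow> real" where
  "lagrangian P B0 u \<mu> = payoff P u + \<mu> * (constraint P u - B0)"

definition saddle_point ::
  "('n::finite, 'm::finite) control_problem \<Rightarrow> real \<Rightarrow> (real \<Rightarrow> real^'m) \<Rightarrow> real \<Rightarrow> bool" where
  "saddle_point P B0 u \<mu> \<longleftrightarrow> u \<in> controls P \<and>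
     (\<forall>v\<in>controls P. \<forall>\<mu>'.
        lagrangian P B0 v \<mu> \<le> lagrangian P B0 u \<mu> \<and> lagrangian P B0 u \<mu> \<le> lagrangian P B0 u \<mu>')"

definition dual_fun :: "('n::finite, 'm::finite) control_problem \<Rightarrow> real \<Rightarrow> ereal" where
  "dual_fun P \<mu> = (SUP u \<in> controls P. ereal (payoff P u + \<mu> * constraint P u))"

definition dual_optimal :: "('n::finite, 'm::finite) control_problem \<Rightarrow> real \<Rightarrow> real set" where
  "dual_optimal P B0 = {\<mu>. is_arg_min (\<lambda>\<mu>. dual_fun P \<mu> - ereal (\<mu> * B0)) (\<lambda>_. True) \<mu>}"

end

theory Submission
  imports Defs
begin

text \<open>
  Trajectories depend affinely on the control, so \<open>\<C>\<close> is affine and \<open>J\<close> is concave on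
  the convex set of controls. As \<open>B\<^sub>0\<close> is interior, a supporting line of the value function at
  \<open>B\<^sub>0\<close> gives strong duality with attainment, and every dual-optimal \<open>\<mu>\<close> makes
  \<open>u\<^sup>*\<close> maximize \<open>J + \<mu> \<C>\<close>; thus \<open>u\<^sup>*\<close> itself serves as the control
  in (c).

  For (b), joint concavity of the Hamiltonian bounds the increment of the integrand by
  \<open>- d/dt (p \<bullet> (x\<^sub>v - x\<^sub>u))\<close>, which integrates to \<open>- p(T) \<bullet> (x\<^sub>v(T) - x\<^sub>u(T))\<close>.

  For (c), \<open>u\<^sup>*\<close> is perturbed to \<open>u\<^sup>* + e (v - u\<^sup>*)\<close>. The gradient of \<open>f\<close> in \<open>u\<close>
  need not be integrable in \<open>t\<close>, because the growth bound holds only for \<open>u \<in> U\<close>. Only the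
  increment in \<open>x\<close> is therefore differentiated: its difference quotients are dominated by
  concavity and growth in \<open>x\<close>, while the quotient in \<open>u\<close> is bounded below by the full
  increment \<open>f(t, x\<^sup>*, v) - f(t, x\<^sup>*, u\<^sup>*)\<close>. The adjoint equation turns the limit into
  \<open>\<integral> H(t, x\<^sup>*, v, p) - H(t, x\<^sup>*, u\<^sup>*, p) dt \<le> 0\<close> for all controls \<open>v\<close>.
\<close>

section \<open>Measurability, and integration by parts for absolutely continuous functions\<close>

lemma bounded_bilinear_matrix_vector_mult:
  "bounded_bilinear ((*v) :: real^'n^'m \<Rightarrow> real^'n \<Rightarrow> real^'m)"
  unfolding bilinear_conv_bounded_bilinear[symmetric] bilinear_def
  by (auto intro!: linearI simp: matrix_vector_mult_add_rdistrib matrix_vector_right_distrib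
      scaleR_matrix_vector_assoc matrix_vector_mult_scaleR)

lemma borel_measurable_matrix_vector_mult [measurable (raw)]:
  fixes A :: "'a \<Rightarrow> real^'n^'m" and x :: "'a \<Rightarrow> real^'n"
  assumes "A \<in> borel_measurable M" "x \<in> borel_measurable M"
  shows "(\<lambda>t. A t *v x t) \<in> borel_measurable M"
  by (rule borel_measurable_continuous_Pair[OF assms])
    (intro bounded_bilinear.continuous_on[OF bounded_bilinear_matrix_vector_mult] continuous_intros)

lemma norm_matrix_vector_mult_le:
  fixes A :: "'a \<Rightarrow> real^'n^'m"
  assumes "bounded (A ` S)"
  obtains K where "K \<ge> 0" "\<And>t v. t \<in> S \<Longrightarrow> norm (A t *v v) \<le> K * norm v"
proof -
  obtain K1 where K1: "K1 > 0" "\<And>a b. norm ((a :: real^'n^'m) *v b) \<le> norm a * norm b * K1"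
    using bounded_bilinear.pos_bounded[OF bounded_bilinear_matrix_vector_mult] by blast
  obtain K2 where K2: "K2 > 0" "\<And>t. t \<in> S \<Longrightarrow> norm (A t) \<le> K2"
    using assms unfolding bounded_pos by blast
  show thesis
  proof
    show "K2 * K1 \<ge> 0" using K1 K2 by simp
    fix t v assume t: "t \<in> S"
    have "norm (A t *v v) \<le> norm (A t) * norm v * K1" by (rule K1)
    also have "\<dots> \<le> K2 * norm v * K1"
      using K2(2)[OF t] K1 by (intro mult_right_mono) auto
    finally show "norm (A t *v v) \<le> K2 * K1 * norm v" by (simp add: mult_ac)
  qed
qed

text \<open>Completeness of Lebesgue measure carries measurability across null sets; extending both
  functions by zero reduces the claim to the whole space.\<close>

lemma borel_measurable_AE_lebesgue_on:
  fixes f :: "'a::euclidean_space \<Rightarrow> 'b::euclidean_space"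
  assumes "f \<in> borel_measurable (lebesgue_on S)" "AE x in lebesgue_on S. f x = g x" "S \<in> sets lebesgue"
  shows "g \<in> borel_measurable (lebesgue_on S)"
proof -
  have "(\<lambda>x. if x \<in> S then f x else 0) \<in> borel_measurable lebesgue"
    using assms by (simp add: borel_measurable_if)
  moreover have "AE x in lebesgue. (if x \<in> S then f x else 0) = (if x \<in> S then g x else 0)"
    using assms(2,3) by (auto simp: AE_restrict_space_iff elim!: eventually_mono)
  ultimately have "(\<lambda>x. if x \<in> S then g x else 0) \<in> borel_measurable lebesgue"
    by (rule borel_measurable_AE)
  then show ?thesis
    using assms(3) by (simp add: borel_measurable_if)
qed

text \<open>Substituting a simple function \<open>s i\<close> only glues countably many measurable
  pieces, and continuity of \<open>F t\<close> passes to the limit for almost every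
  \<open>t\<close>.\<close>

lemma measurable_Caratheodory:
  fixes F :: "'a::euclidean_space \<Rightarrow> 'b::{metric_space, second_countable_topology} \<Rightarrow> 'c::euclidean_space"
  assumes meas: "\<And>z. (\<lambda>t. F t z) \<in> borel_measurable (lebesgue_on S)"
    and cont: "AE t in lebesgue_on S. continuous_on UNIV (F t)"
    and z: "z \<in> borel_measurable (lebesgue_on S)" and S: "S \<in> sets lebesgue"
  shows "(\<lambda>t. F t (z t)) \<in> borel_measurable (lebesgue_on S)"
proof -
  obtain s where s: "\<And>i. simple_function (lebesgue_on S) (s i)"
      "\<And>t. t \<in> S \<Longrightarrow> (\<lambda>i. s i t) \<longlonglongrightarrow> z t"
    using borel_measurable_implies_sequence_metric[OF z, of undefined] by auto
  have Fs: "(\<lambda>t. F t (s i t)) \<in> borel_measurable (lebesgue_on S)" for i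
  proof (rule measurable_compose_countable'[where f="\<lambda>v t. F t v" and I="s i ` S"])
    show "s i \<in> measurable (lebesgue_on S) (count_space (s i ` S))"
      using measurable_simple_function[OF s(1)[of i]]
      by (auto simp: measurable_def vimage_def Int_def)
    show "countable (s i ` S)"
      using s(1)[of i] by (simp add: simple_function_def countable_finite)
  qed (rule meas)
  \<comment> \<open>\<open>lim\<close> is total, so \<open>L\<close> is measurable; on the null set
    where \<open>F t\<close> is not continuous its value is arbitrary, which the almost everywhere
    lemma absorbs.\<close>
  define L where "L t = lim (\<lambda>i. F t (s i t))" for t
  have "L \<in> borel_measurable (lebesgue_on S)"
    unfolding L_def by (rule borel_measurable_lim_metric) (rule Fs)
  moreover have "AE t in lebesgue_on S. t \<in> S"
    by (rule AE_I2) auto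
  with cont have "AE t in lebesgue_on S. L t = F t (z t)"
  proof eventually_elim
    case (elim t)
    then have "(\<lambda>i. F t (s i t)) \<longlonglongrightarrow> F t (z t)"
      using s(2)[of t] by (intro continuous_on_tendsto_compose[of UNIV "F t"]) auto
    then show ?case by (simp add: L_def limI)
  qed
  ultimately show ?thesis
    using S by (rule borel_measurable_AE_lebesgue_on)
qed

lemma AE_lebesgue_on_subset:
  assumes "AE t in lebesgue_on S. P t" "R \<subseteq> S" "R \<in> sets lebesgue" "S \<in> sets lebesgue"
  shows "AE t in lebesgue_on R. P t"
  using assms by (auto simp: AE_restrict_space_iff elim!: eventually_mono)

lemma integrable_lebesgue_on_subset:
  fixes f :: "'a::euclidean_space \<Rightarrow> 'b::{banach, second_countable_topology}"
  assumes "integrable (lebesgue_on S) f" "R \<subseteq> S" "R \<in> sets lebesgue" "S \<in> sets lebesgue"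
  shows "integrable (lebesgue_on R) f"
proof -
  have "set_integrable lebesgue S f"
    using assms by (simp add: set_integrable_def integrable_restrict_space)
  then have "set_integrable lebesgue R f"
    by (rule set_integrable_subset) (use assms in auto)
  then show ?thesis
    using assms by (simp add: set_integrable_def integrable_restrict_space)
qed

lemma integral_lebesgue_on_subset:
  fixes f :: "'a::euclidean_space \<Rightarrow> 'b::{banach, second_countable_topology}"
  assumes "R \<subseteq> S" "R \<in> sets lebesgue" "S \<in> sets lebesgue"
  shows "integral\<^sup>L (lebesgue_on R) f = integral\<^sup>L (lebesgue_on S) (\<lambda>t. indicator R t *\<^sub>R f t)"
proof -
  have "indicator S t *\<^sub>R indicator R t *\<^sub>R f t = indicator R t *\<^sub>R f t" for t
    using assms(1) by (auto simp: indicator_def)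
  then show ?thesis
    using assms by (simp add: integral_restrict_space del: scaleR_scaleR)
qed

section \<open>Absolutely continuous functions and integration by parts\<close>

lemma W11_derivD:
  assumes "W11_deriv T x dx" "t \<in> {0..T}"
  shows "x t = x 0 + integral\<^sup>L (lebesgue_on {0..t}) dx"
  using assms unfolding W11_deriv_def by metis

text \<open>The closed and the half-open cut serve the two complementary triangles
  \<open>s \<le> t\<close> and \<open>t < s\<close> in the Fubini argument below.\<close>

lemma W11_deriv_integral_indicator:
  assumes "W11_deriv T x dx" "t \<in> {0..T}"
  shows "integral\<^sup>L (lebesgue_on {0..T}) (\<lambda>s. indicator {..t} s *\<^sub>R dx s) = x t - x 0"
    and "integral\<^sup>L (lebesgue_on {0..T}) (\<lambda>s. indicator {..<t} s *\<^sub>R dx s) = x t - x 0"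
proof -
  have "integral\<^sup>L (lebesgue_on {0..t}) dx
      = integral\<^sup>L (lebesgue_on {0..T}) (\<lambda>s. indicator {0..t} s *\<^sub>R dx s)"
    using assms by (intro integral_lebesgue_on_subset) auto
  also have "\<dots> = integral\<^sup>L (lebesgue_on {0..T}) (\<lambda>s. indicator {..t} s *\<^sub>R dx s)"
    by (intro Bochner_Integration.integral_cong) (auto simp: indicator_def)
  finally show 1: "integral\<^sup>L (lebesgue_on {0..T}) (\<lambda>s. indicator {..t} s *\<^sub>R dx s) = x t - x 0"
    using W11_derivD[OF assms] by simp
  have dx: "dx \<in> borel_measurable (lebesgue_on {0..T})"
    using assms(1) by (auto simp: W11_deriv_def)
  have "AE s in lebesgue. s \<noteq> t"
    by (intro AE_completion AE_lborel_singleton)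
  then have ae: "AE s in lebesgue_on {0..T}. s \<noteq> t"
    by (auto simp: AE_restrict_space_iff elim!: eventually_mono)
  have idm: "(\<lambda>s. s) \<in> borel_measurable (lebesgue_on {0..T})"
    using id_borel_measurable_lebesgue_on[of "{0..T}"] by (simp add: id_def)
  have "integral\<^sup>L (lebesgue_on {0..T}) (\<lambda>s. indicator {..<t} s *\<^sub>R dx s)
      = integral\<^sup>L (lebesgue_on {0..T}) (\<lambda>s. indicator {..t} s *\<^sub>R dx s)"
    by (rule integral_cong_AE)
      (use dx idm ae in \<open>auto simp: indicator_def elim!: eventually_mono\<close>)
  with 1 show "integral\<^sup>L (lebesgue_on {0..T}) (\<lambda>s. indicator {..<t} s *\<^sub>R dx s) = x t - x 0"
    by simp
qed

text \<open>The integral of \<open>dp s \<bullet> dy t\<close> over the square is split along the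
  diagonal, and each triangle is integrated first in the variable that produces an increment of
  \<open>p\<close> or of \<open>y\<close>. Fubini yields the integrability of the products as
  well.\<close>

lemma W11_deriv_inner:
  assumes p: "W11_deriv T p dp" and y: "W11_deriv T y dy" and T: "0 \<le> T"
  shows "has_bochner_integral (lebesgue_on {0..T}) (\<lambda>t. dp t \<bullet> y t + p t \<bullet> dy t)
           (p T \<bullet> y T - p 0 \<bullet> y 0)"
proof -
  define M where "M = lebesgue_on {0..T}"
  have spM: "space M = {0..T}" by (simp add: M_def)
  interpret finite_measure M
    unfolding M_def by (rule finite_measure_lebesgue_on) simp
  interpret pair_sigma_finite M M ..
  have ip: "integrable M dp" and iy: "integrable M dy"
    using p y by (auto simp: W11_deriv_def M_def)
  have [measurable]: "dp \<in> borel_measurable M" "dy \<in> borel_measurable M"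
    using ip iy by auto
  have [measurable]: "(\<lambda>s. s) \<in> borel_measurable M"
    using id_borel_measurable_lebesgue_on[of "{0..T}"] by (simp add: id_def M_def)
  have iN: "integrable (M \<Otimes>\<^sub>M M) (\<lambda>(s,t). norm (dp s) * norm (dy t))"
    by (rule Fubini_integrable) (use ip iy in auto)
  define F where "F = (\<lambda>(s,t). indicator {..t} s * (dp s \<bullet> dy t))"
  define G where "G = (\<lambda>(s,t). indicator {..<s} t * (dp s \<bullet> dy t))"
  have [measurable]: "F \<in> borel_measurable (M \<Otimes>\<^sub>M M)" "G \<in> borel_measurable (M \<Otimes>\<^sub>M M)"
  proof -
    \<comment> \<open>Written as a comparison of coordinates, the indicators are measurable on the
      product.\<close>
    have "F = (\<lambda>z. if fst z \<le> snd z then dp (fst z) \<bullet> dy (snd z) else 0)"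
      "G = (\<lambda>z. if snd z < fst z then dp (fst z) \<bullet> dy (snd z) else 0)"
      by (auto simp: F_def G_def fun_eq_iff)
    then show "F \<in> borel_measurable (M \<Otimes>\<^sub>M M)" "G \<in> borel_measurable (M \<Otimes>\<^sub>M M)"
      by (simp_all only:) measurable
  qed
  have iF: "integrable (M \<Otimes>\<^sub>M M) F" and iG: "integrable (M \<Otimes>\<^sub>M M) G"
    by (auto intro!: Bochner_Integration.integrable_bound[OF iN]
        simp: F_def G_def indicator_def Cauchy_Schwarz_ineq2)
  have Fint: "(LINT s|M. F (s,t)) = (p t - p 0) \<bullet> dy t" if t: "t \<in> {0..T}" for t
  proof -
    have "integrable M (\<lambda>s. indicator {..t} s *\<^sub>R dp s)"
      by (rule Bochner_Integration.integrable_bound[OF ip]) (auto simp: indicator_def)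
    then have "(LINT s|M. (indicator {..t} s *\<^sub>R dp s) \<bullet> dy t) = (p t - p 0) \<bullet> dy t"
      using W11_deriv_integral_indicator(1)[OF p t] by (simp add: M_def del: inner_scaleR_left)
    then show ?thesis by (simp add: F_def)
  qed
  have Gint: "(LINT t|M. G (s,t)) = dp s \<bullet> (y s - y 0)" if s: "s \<in> {0..T}" for s
  proof -
    have "integrable M (\<lambda>t. indicator {..<s} t *\<^sub>R dy t)"
      by (rule Bochner_Integration.integrable_bound[OF iy]) (auto simp: indicator_def)
    then have "(LINT t|M. dp s \<bullet> (indicator {..<s} t *\<^sub>R dy t)) = dp s \<bullet> (y s - y 0)"
      using W11_deriv_integral_indicator(2)[OF y s] by (simp add: M_def del: inner_scaleR_right)
    then show ?thesis by (simp add: G_def)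
  qed
  have I1: "integrable M (\<lambda>t. (p t - p 0) \<bullet> dy t)"
  proof -
    have "integrable M (\<lambda>t. LINT s|M. F (s,t))"
      using integrable_snd[of "\<lambda>s t. F (s,t)"] iF by simp
    then show ?thesis
      by (subst Bochner_Integration.integrable_cong[OF refl]) (auto simp: Fint spM)
  qed
  have I2: "integrable M (\<lambda>s. dp s \<bullet> (y s - y 0))"
  proof -
    have "integrable M (\<lambda>s. LINT t|M. G (s,t))"
      using integrable_fst[of "\<lambda>s t. G (s,t)"] iG by simp
    then show ?thesis
      by (subst Bochner_Integration.integrable_cong[OF refl]) (auto simp: Gint spM)
  qed
  have E1: "integral\<^sup>L (M \<Otimes>\<^sub>M M) F = (LINT t|M. (p t - p 0) \<bullet> dy t)"
  proof -
    have "integral\<^sup>L (M \<Otimes>\<^sub>M M) F = (LINT t|M. LINT s|M. F (s,t))"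
      using integral_snd[of "\<lambda>s t. F (s,t)"] iF by simp
    also have "\<dots> = (LINT t|M. (p t - p 0) \<bullet> dy t)"
      by (intro Bochner_Integration.integral_cong) (auto simp: Fint spM)
    finally show ?thesis .
  qed
  have E2: "integral\<^sup>L (M \<Otimes>\<^sub>M M) G = (LINT s|M. dp s \<bullet> (y s - y 0))"
  proof -
    have "integral\<^sup>L (M \<Otimes>\<^sub>M M) G = (LINT s|M. LINT t|M. G (s,t))"
      using integral_fst[of "\<lambda>s t. G (s,t)"] iG by simp
    also have "\<dots> = (LINT s|M. dp s \<bullet> (y s - y 0))"
      by (intro Bochner_Integration.integral_cong) (auto simp: Gint spM)
    finally show ?thesis .
  qed
  have dp: "integral\<^sup>L M dp = p T - p 0" and dy: "integral\<^sup>L M dy = y T - y 0"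
    using W11_derivD[OF p, of T] W11_derivD[OF y, of T] T by (simp_all add: M_def)
  have FG: "F (s,t) + G (s,t) = dp s \<bullet> dy t" for s t
    by (auto simp: F_def G_def indicator_def)
  have "integral\<^sup>L (M \<Otimes>\<^sub>M M) F + integral\<^sup>L (M \<Otimes>\<^sub>M M) G
      = integral\<^sup>L (M \<Otimes>\<^sub>M M) (\<lambda>z. F z + G z)"
    using iF iG by simp
  also have "\<dots> = (LINT s|M. LINT t|M. F (s,t) + G (s,t))"
    using integral_fst[of "\<lambda>s t. F (s,t) + G (s,t)"] iF iG by (simp add: case_prod_unfold)
  also have "\<dots> = (p T - p 0) \<bullet> (y T - y 0)"
    using ip iy by (simp add: FG dp dy)
  finally have main: "(LINT t|M. (p t - p 0) \<bullet> dy t) + (LINT s|M. dp s \<bullet> (y s - y 0))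
      = (p T - p 0) \<bullet> (y T - y 0)"
    by (simp add: E1 E2)
  \<comment> \<open>Fubini controls only increments from time 0; the constant parts
    \<open>p 0\<close> and \<open>y 0\<close> are integrated separately.\<close>
  have split: "dp t \<bullet> y t + p t \<bullet> dy t
      = ((p t - p 0) \<bullet> dy t + dp t \<bullet> (y t - y 0)) + (p 0 \<bullet> dy t + dp t \<bullet> y 0)" for t
    by (simp add: algebra_simps)
  have i3: "integrable M (\<lambda>t. p 0 \<bullet> dy t + dp t \<bullet> y 0)"
    using ip iy by simp
  have e3: "(LINT t|M. p 0 \<bullet> dy t + dp t \<bullet> y 0) = p 0 \<bullet> (y T - y 0) + (p T - p 0) \<bullet> y 0"
    using ip iy by (simp add: dp dy)
  have "has_bochner_integral M (\<lambda>t. dp t \<bullet> y t + p t \<bullet> dy t)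
    ((p T - p 0) \<bullet> (y T - y 0) + (p 0 \<bullet> (y T - y 0) + (p T - p 0) \<bullet> y 0))"
    unfolding split
    using I1 I2 i3 main e3 by (simp add: has_bochner_integral_iff)
  then show ?thesis
    by (simp add: M_def algebra_simps inner_commute)
qed

section \<open>Continuity and linear combinations of absolutely continuous functions\<close>

lemma W11_deriv_integrable_on:
  assumes "W11_deriv T x dx" "t \<in> {0..T}"
  shows "integrable (lebesgue_on {0..t}) dx"
proof -
  have "integrable (lebesgue_on {0..T}) dx" using assms by (simp add: W11_deriv_def)
  then show ?thesis
    by (rule integrable_lebesgue_on_subset) (use assms in auto)
qed

lemma W11_deriv_eq:
  assumes "W11_deriv T x dx" "t \<in> {0..T}"
  shows "x t = x 0 + integral {0..t} dx"
  using W11_derivD[OF assms] lebesgue_integral_eq_integral[OF W11_deriv_integrable_on[OF assms]] by simp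

lemma W11_deriv_continuous:
  assumes "W11_deriv T x dx"
  shows "continuous_on {0..T} x"
proof -
  have i: "integrable (lebesgue_on {0..T}) dx" using assms by (simp add: W11_deriv_def)
  have "continuous_on {0..T} (\<lambda>t. x 0 + integral {0..t} dx)"
    by (intro continuous_intros indefinite_integral_continuous_1 integrable_on_lebesgue_on[OF i]) simp
  then show ?thesis
    by (rule continuous_on_eq) (rule W11_deriv_eq[OF assms, symmetric])
qed

lemma W11_deriv_diff:
  assumes x: "W11_deriv T x dx" and y: "W11_deriv T y dy"
  shows "W11_deriv T (\<lambda>t. x t - y t) (\<lambda>t. dx t - dy t)"
  unfolding W11_deriv_def
proof (intro conjI ballI)
  show "integrable (lebesgue_on {0..T}) (\<lambda>t. dx t - dy t)"
    using assms by (simp add: W11_deriv_def)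
next
  fix t assume t: "t \<in> {0..T}"
  have "x t - y t = (x 0 + integral\<^sup>L (lebesgue_on {0..t}) dx) - (y 0 + integral\<^sup>L (lebesgue_on {0..t}) dy)"
    using assms t unfolding W11_deriv_def by metis
  then show "x t - y t = x 0 - y 0 + (LINT s|lebesgue_on {0..t}. dx s - dy s)"
    using W11_deriv_integrable_on[OF x t] W11_deriv_integrable_on[OF y t] by simp
qed

lemma W11_deriv_scaleR:
  assumes "W11_deriv T x dx"
  shows "W11_deriv T (\<lambda>t. c *\<^sub>R x t) (\<lambda>t. c *\<^sub>R dx t)"
  unfolding W11_deriv_def
proof (intro conjI ballI)
  show "integrable (lebesgue_on {0..T}) (\<lambda>t. c *\<^sub>R dx t)"
    using assms by (simp add: W11_deriv_def)
next
  fix t assume t: "t \<in> {0..T}"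
  have "x t = x 0 + integral\<^sup>L (lebesgue_on {0..t}) dx"
    by (rule W11_derivD[OF assms t])
  then show "c *\<^sub>R x t = c *\<^sub>R x 0 + (LINT s|lebesgue_on {0..t}. c *\<^sub>R dx s)"
    by (metis integral_scaleR_right scaleR_add_right)
qed

lemma W11_deriv_add:
  assumes "W11_deriv T x dx" "W11_deriv T y dy"
  shows "W11_deriv T (\<lambda>t. x t + y t) (\<lambda>t. dx t + dy t)"
  using W11_deriv_diff[OF assms(1) W11_deriv_scaleR[OF assms(2), of "-1"]] by simp

text \<open>\<open>is_trajectory\<close> provides a derivative that agrees with the right-hand side
  only almost everywhere; this lets the right-hand side itself serve as the derivative.\<close>

lemma W11_deriv_cong_AE:
  assumes x: "W11_deriv T x dx" and ae: "AE t in lebesgue_on {0..T}. dx t = dy t"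
    and dy: "dy \<in> borel_measurable (lebesgue_on {0..T})"
  shows "W11_deriv T x dy"
  unfolding W11_deriv_def
proof (intro conjI ballI)
  have i: "integrable (lebesgue_on {0..T}) dx" using x by (simp add: W11_deriv_def)
  then show j: "integrable (lebesgue_on {0..T}) dy"
    using integrable_cong_AE_imp[OF i dy] ae by (auto elim: eventually_mono)
  fix t assume t: "t \<in> {0..T}"
  have "integral\<^sup>L (lebesgue_on {0..t}) dx = integral\<^sup>L (lebesgue_on {0..t}) dy"
  proof (rule integral_cong_AE)
    show "AE s in lebesgue_on {0..t}. dx s = dy s"
      using t by (intro AE_lebesgue_on_subset[OF ae]) auto
  qed (use t W11_deriv_integrable_on[OF x t] integrable_lebesgue_on_subset[OF j, of "{0..t}"] in auto)
  then show "x t = x 0 + integral\<^sup>L (lebesgue_on {0..t}) dy"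
    using x t unfolding W11_deriv_def by metis
qed


section \<open>Linear initial value problems with measurable coefficients\<close>

lemma integrable_bounded_on_ivl:
  fixes f :: "real \<Rightarrow> 'a::euclidean_space"
  assumes "f \<in> borel_measurable (lebesgue_on {a..b})" "AE t in lebesgue_on {a..b}. norm (f t) \<le> K"
  shows "integrable (lebesgue_on {a..b}) f"
proof -
  interpret finite_measure "lebesgue_on {a..b}"
    by (rule finite_measure_lebesgue_on) simp
  show ?thesis
    using assms(2,1) by (rule integrable_const_bound)
qed

text \<open>An exponential weight centred at \<open>s0\<close> gains the factor \<open>1 / k\<close>
  under integration, which makes Picard operators contractive on an interval of any length. Both
  sides of \<open>s0\<close> are treated because the adjoint equation is solved backwards from the
  terminal time.\<close>

lemma norm_integral_increment_le_exp:
  fixes f :: "real \<Rightarrow> 'a::euclidean_space"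
  assumes f: "f integrable_on {0..T}" and s0: "s0 \<in> {0..T}" and t: "t \<in> {0..T}"
    and k: "k > 0" and C: "C \<ge> 0"
    and le: "\<And>s. s \<in> {0..T} \<Longrightarrow> norm (f s) \<le> C * exp (k * \<bar>s - s0\<bar>)"
  shows "norm (integral {0..t} f - integral {0..s0} f) \<le> C / k * exp (k * \<bar>t - s0\<bar>)"
proof (cases "s0 \<le> t")
  case True
  have ft: "f integrable_on {0..t}" "f integrable_on {s0..t}"
    using s0 t by (auto intro: integrable_on_subinterval[OF f])
  have I: "((\<lambda>s. C * exp (k * (s - s0))) has_integral
      C / k * exp (k * (t - s0)) - C / k * exp (k * (s0 - s0))) {s0..t}"
    by (rule fundamental_theorem_of_calculus[OF True])
      (use k in \<open>auto intro!: derivative_eq_intros simp: has_real_derivative_iff_has_vector_derivative[symmetric]\<close>)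
  have "norm (integral {s0..t} f) \<le> integral {s0..t} (\<lambda>s. C * exp (k * (s - s0)))"
  proof (rule integral_norm_bound_integral[OF ft(2) has_integral_integrable[OF I]])
    fix s assume "s \<in> {s0..t}"
    then show "norm (f s) \<le> C * exp (k * (s - s0))"
      using le[of s] s0 t by auto
  qed
  also have "\<dots> \<le> C / k * exp (k * \<bar>t - s0\<bar>)"
    using True k C unfolding integral_unique[OF I] by simp
  finally have "norm (integral {s0..t} f) \<le> C / k * exp (k * \<bar>t - s0\<bar>)" .
  moreover have "integral {0..t} f - integral {0..s0} f = integral {s0..t} f"
    using Henstock_Kurzweil_Integration.integral_combine[of 0 s0 t f] ft True s0 by (auto simp: algebra_simps)
  ultimately show ?thesis by simp
next
  case False
  then have ts: "t \<le> s0" by simp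
  have ft: "f integrable_on {0..s0}" "f integrable_on {t..s0}"
    using s0 t by (auto intro: integrable_on_subinterval[OF f])
  have I: "((\<lambda>s. C * exp (k * (s0 - s))) has_integral
      - (C / k) * exp (k * (s0 - s0)) - - (C / k) * exp (k * (s0 - t))) {t..s0}"
    by (rule fundamental_theorem_of_calculus[OF ts])
      (use k in \<open>auto intro!: derivative_eq_intros simp: has_real_derivative_iff_has_vector_derivative[symmetric]\<close>)
  have "norm (integral {t..s0} f) \<le> integral {t..s0} (\<lambda>s. C * exp (k * (s0 - s)))"
  proof (rule integral_norm_bound_integral[OF ft(2) has_integral_integrable[OF I]])
    fix s assume "s \<in> {t..s0}"
    then show "norm (f s) \<le> C * exp (k * (s0 - s))"
      using le[of s] s0 t by auto
  qed
  also have "\<dots> \<le> C / k * exp (k * \<bar>t - s0\<bar>)"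
    using False k C unfolding integral_unique[OF I] by simp
  finally have "norm (integral {t..s0} f) \<le> C / k * exp (k * \<bar>t - s0\<bar>)" .
  moreover have "integral {0..t} f - integral {0..s0} f = - integral {t..s0} f"
    using Henstock_Kurzweil_Integration.integral_combine[of 0 t s0 f] ft ts t by (auto simp: algebra_simps)
  ultimately show ?thesis by simp
qed

text \<open>Banach's fixed point theorem for the Picard operator in an exponentially weighted
  (Bielecki) sup norm gives a solution on all of \<open>{0..T}\<close> at once. The prescribed time
  \<open>s0\<close> is free, so that initial and terminal value problems are both covered.\<close>

lemma linear_ivp_exists:
  fixes A :: "real \<Rightarrow> real^'n^'n" and g :: "real \<Rightarrow> real^'n"
  assumes A: "meas_bdd T A" and g: "integrable (lebesgue_on {0..T}) g" and s0: "s0 \<in> {0..T}"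
  obtains x where "W11_deriv T x (\<lambda>t. A t *v x t + g t)" "x s0 = c"
proof -
  obtain K where K: "K \<ge> 0" "\<And>t v. t \<in> {0..T} \<Longrightarrow> norm (A t *v v) \<le> K * norm v"
    using A norm_matrix_vector_mult_le unfolding meas_bdd_def by metis
  \<comment> \<open>The rate makes the contraction factor \<open>K / k\<close> at most 1/2; the
    added 1 keeps \<open>k\<close> positive when \<open>K\<close> is 0.\<close>
  define k where "k = 2 * K + 1"
  have k: "k > 0" "K / k \<le> 1/2" using K(1) by (auto simp: k_def)
  \<comment> \<open>The unknown is rescaled: \<open>z t\<close> stands for the solution divided by
    \<open>exp (k * \<bar>t - s0\<bar>)\<close>, so the plain sup metric on \<open>z\<close> is the
    weighted one on the solution.\<close>
  define h where "h z s = exp (k * \<bar>s - s0\<bar>) *\<^sub>R (A s *v apply_bcontfun z s) + g s"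
    for z :: "real \<Rightarrow>\<^sub>C (real^'n)" and s
  \<comment> \<open>Bounded continuous functions live on the whole line; clamping time to
    \<open>{0..T}\<close> extends the operator there.\<close>
  define cl where "cl t = max 0 (min T t)" for t
  have cl: "cl t \<in> {0..T}" for t using s0 by (auto simp: cl_def)
  have T: "0 \<le> T" using s0 by simp
  have hA: "integrable (lebesgue_on {0..T}) (\<lambda>s. exp (k * \<bar>s - s0\<bar>) *\<^sub>R (A s *v apply_bcontfun z s))" for z
  proof -
    obtain B where B: "\<And>s. norm (apply_bcontfun z s) \<le> B"
      using bounded_apply_bcontfun[of z] unfolding bounded_iff by blast
    show ?thesis
    proof (rule integrable_bounded_on_ivl)
      have "apply_bcontfun z \<in> borel_measurable (lebesgue_on {0..T})"
        "(\<lambda>s. exp (k * \<bar>s - s0\<bar>)) \<in> borel_measurable (lebesgue_on {0..T})"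
        by (auto intro!: continuous_imp_measurable_on_sets_lebesgue continuous_intros)
      then show "(\<lambda>s. exp (k * \<bar>s - s0\<bar>) *\<^sub>R (A s *v apply_bcontfun z s)) \<in> borel_measurable (lebesgue_on {0..T})"
        using A by (auto simp: meas_bdd_def intro!: borel_measurable_scaleR borel_measurable_matrix_vector_mult)
      have "norm (exp (k * \<bar>s - s0\<bar>) *\<^sub>R (A s *v apply_bcontfun z s)) \<le> exp (k * T) * (K * B)"
        if s: "s \<in> {0..T}" for s
      proof -
        have "norm (A s *v apply_bcontfun z s) \<le> K * B"
          using K(2)[OF s, of "apply_bcontfun z s"] mult_left_mono[OF B K(1), of s] by (rule order_trans)
        moreover have "exp (k * \<bar>s - s0\<bar>) \<le> exp (k * T)"
          using s s0 k by (auto simp: abs_le_iff)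
        ultimately show ?thesis by (simp add: mult_mono)
      qed
      then show "AE s in lebesgue_on {0..T}.
          norm (exp (k * \<bar>s - s0\<bar>) *\<^sub>R (A s *v apply_bcontfun z s)) \<le> exp (k * T) * (K * B)"
        by (intro AE_I2) auto
    qed
  qed
  have hL: "integrable (lebesgue_on {0..T}) (h z)" for z
    unfolding h_def using hA[of z] g by (rule Bochner_Integration.integrable_add)
  have hI: "h z integrable_on {0..T}" for z
    using hL by (rule integrable_on_lebesgue_on) simp
  define \<Phi> where "\<Phi> z t = exp (- (k * \<bar>cl t - s0\<bar>)) *\<^sub>R
      (c + (integral {0..cl t} (h z) - integral {0..s0} (h z)))" for z t
  have Phi: "\<Phi> z \<in> bcontfun" for z
  proof -
    define \<psi> where "\<psi> t = exp (- (k * \<bar>t - s0\<bar>)) *\<^sub>R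
      (c + (integral {0..t} (h z) - integral {0..s0} (h z)))" for t
    have \<psi>: "continuous_on {0..T} \<psi>"
      unfolding \<psi>_def by (intro continuous_intros indefinite_integral_continuous_1 hI)
    have eq: "\<Phi> z = (\<lambda>t. \<psi> (cl t))" by (simp add: \<Phi>_def \<psi>_def fun_eq_iff)
    have "continuous_on UNIV cl" unfolding cl_def by (intro continuous_intros)
    then have "continuous_on UNIV (\<Phi> z)"
      unfolding eq by (rule continuous_on_compose2[OF \<psi>]) (use cl in auto)
    moreover have "bounded (\<psi> ` {0..T})"
      using \<psi> by (intro compact_imp_bounded compact_continuous_image) auto
    then have "bounded (range (\<Phi> z))"
      by (rule bounded_subset) (use cl in \<open>auto simp: eq\<close>)
    ultimately show ?thesis by (simp add: bcontfun_def)
  qed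
  define \<Psi> where "\<Psi> z = Bcontfun (\<Phi> z)" for z
  have ap: "apply_bcontfun (\<Psi> z) = \<Phi> z" for z
    by (simp add: \<Psi>_def Bcontfun_inverse Phi)
  have "dist (\<Psi> z1) (\<Psi> z2) \<le> 1/2 * dist z1 z2" for z1 z2
  proof (rule dist_bound)
    fix t
    define f where "f s = h z1 s - h z2 s" for s
    have int: "h z integrable_on {0..r}" if "r \<in> {0..T}" for z r
      using that by (intro integrable_on_subinterval[OF hI]) auto
    have f_eq: "f s = exp (k * \<bar>s - s0\<bar>) *\<^sub>R (A s *v (apply_bcontfun z1 s - apply_bcontfun z2 s))" for s
      by (simp add: f_def h_def matrix_vector_mult_diff_distrib scaleR_diff_right)
    have fn: "norm (f s) \<le> (K * dist z1 z2) * exp (k * \<bar>s - s0\<bar>)" if s: "s \<in> {0..T}" for s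
    proof -
      have "norm (A s *v (apply_bcontfun z1 s - apply_bcontfun z2 s)) \<le> K * dist z1 z2"
        using K(2)[OF s] mult_left_mono[OF dist_bounded[of z1 s z2] K(1)]
        by (metis dist_norm order_trans)
      then show ?thesis by (simp add: f_eq mult_ac)
    qed
    have "integral {0..cl t} f - integral {0..s0} f
        = (integral {0..cl t} (h z1) - integral {0..s0} (h z1))
          - (integral {0..cl t} (h z2) - integral {0..s0} (h z2))"
      unfolding f_def using int[OF cl[of t]] int[OF s0]
      by (simp add: Henstock_Kurzweil_Integration.integral_diff)
    then have "\<Phi> z1 t - \<Phi> z2 t = exp (- (k * \<bar>cl t - s0\<bar>)) *\<^sub>R (integral {0..cl t} f - integral {0..s0} f)"
      by (simp add: \<Phi>_def scaleR_diff_right[symmetric] algebra_simps del: scaleR_diff_right)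
    then have "dist (\<Phi> z1 t) (\<Phi> z2 t)
        = exp (- (k * \<bar>cl t - s0\<bar>)) * norm (integral {0..cl t} f - integral {0..s0} f)"
      by (simp add: dist_norm)
    \<comment> \<open>The weight in front cancels the exponential growth in the estimate and leaves
      \<open>K / k\<close>.\<close>
    also have "\<dots> \<le> exp (- (k * \<bar>cl t - s0\<bar>)) * (K * dist z1 z2 / k * exp (k * \<bar>cl t - s0\<bar>))"
      unfolding f_def
      by (intro mult_left_mono norm_integral_increment_le_exp[OF _ s0 cl k(1)])
        (use fn K hI in \<open>auto simp: f_def intro!: Henstock_Kurzweil_Integration.integrable_diff\<close>)
    also have "\<dots> = K / k * dist z1 z2"
      by (simp add: exp_minus)
    also have "\<dots> \<le> 1/2 * dist z1 z2"
      using k(2) by (rule mult_right_mono) simp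
    finally show "dist (apply_bcontfun (\<Psi> z1) t) (apply_bcontfun (\<Psi> z2) t) \<le> 1/2 * dist z1 z2"
      by (simp add: ap)
  qed
  then have "\<exists>!z. \<Psi> z = z"
    by (intro banach_fix_type[of "1/2"]) auto
  then obtain z where z: "\<Psi> z = z" by blast
  \<comment> \<open>Undoing the rescaling turns the fixed point into the solution.\<close>
  define x where "x t = exp (k * \<bar>t - s0\<bar>) *\<^sub>R apply_bcontfun z t" for t
  have hx: "h z = (\<lambda>s. A s *v x s + g s)"
    by (simp add: h_def x_def matrix_vector_mult_scaleR fun_eq_iff)
  have x: "x t = c + (integral {0..t} (h z) - integral {0..s0} (h z))" if t: "t \<in> {0..T}" for t
  proof -
    have "cl t = t" using t by (auto simp: cl_def)
    then have "apply_bcontfun z t = exp (- (k * \<bar>t - s0\<bar>)) *\<^sub>R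
        (c + (integral {0..t} (h z) - integral {0..s0} (h z)))"
      using ap[of z] by (simp add: z \<Phi>_def fun_eq_iff)
    then show ?thesis by (simp add: x_def exp_minus)
  qed
  show thesis
  proof
    show "x s0 = c" using x[OF s0] by simp
    show "W11_deriv T x (\<lambda>t. A t *v x t + g t)"
      unfolding W11_deriv_def hx[symmetric]
    proof (intro conjI ballI hL)
      fix t assume t: "t \<in> {0..T}"
      have "integrable (lebesgue_on {0..t}) (h z)"
        using t by (intro integrable_lebesgue_on_subset[OF hL]) auto
      then have "integral\<^sup>L (lebesgue_on {0..t}) (h z) = integral {0..t} (h z)"
        by (rule lebesgue_integral_eq_integral) simp
      then show "x t = x 0 + integral\<^sup>L (lebesgue_on {0..t}) (h z)"
        using x[OF t] x[of 0] T by simp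
    qed
  qed
qed

text \<open>At a maximum \<open>r\<close> of the weighted norm \<open>w\<close>, the exponential
  estimate gives \<open>w r \<le> 1/2 * w r\<close>, so \<open>w\<close> vanishes.\<close>

lemma linear_ivp_unique:
  fixes A :: "real \<Rightarrow> real^'n^'n"
  assumes A: "meas_bdd T A" and d: "W11_deriv T d (\<lambda>t. A t *v d t)" and d0: "d 0 = 0"
    and t: "t \<in> {0..T}"
  shows "d t = 0"
proof -
  obtain K where K: "K \<ge> 0" "\<And>t v. t \<in> {0..T} \<Longrightarrow> norm (A t *v v) \<le> K * norm v"
    using A norm_matrix_vector_mult_le unfolding meas_bdd_def by metis
  define k where "k = 2 * K + 1"
  have k: "k > 0" "K / k \<le> 1/2" using K(1) by (auto simp: k_def)
  have T: "0 \<in> {0..T}" using t by auto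
  define w where "w t = exp (- (k * t)) * norm (d t)" for t
  have "continuous_on {0..T} w"
    unfolding w_def by (intro continuous_intros W11_deriv_continuous[OF d])
  then obtain r where r: "r \<in> {0..T}" and max: "\<And>s. s \<in> {0..T} \<Longrightarrow> w s \<le> w r"
    using continuous_attains_sup[of "{0..T}" w] T by auto
  have "norm (integral {0..r} (\<lambda>t. A t *v d t) - integral {0..0} (\<lambda>t. A t *v d t))
      \<le> (K * w r) / k * exp (k * \<bar>r - 0\<bar>)"
  proof (rule norm_integral_increment_le_exp[OF _ T r k(1)])
    show "(\<lambda>t. A t *v d t) integrable_on {0..T}"
      using d by (intro integrable_on_lebesgue_on) (auto simp: W11_deriv_def)
    show "0 \<le> K * w r" using K(1) by (simp add: w_def)
    fix s assume s: "s \<in> {0..T}"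
    have "norm (d s) \<le> w r * exp (k * s)"
      using max[OF s] by (simp add: w_def[of s] exp_minus field_simps)
    then have "K * norm (d s) \<le> K * (w r * exp (k * s))"
      by (rule mult_left_mono) (rule K(1))
    then show "norm (A s *v d s) \<le> K * w r * exp (k * \<bar>s - 0\<bar>)"
      using K(2)[OF s, of "d s"] s by (simp add: mult_ac)
  qed
  then have "norm (d r) \<le> K * w r / k * exp (k * r)"
    using W11_deriv_eq[OF d r] d0 r by simp
  then have "w r \<le> K / k * w r"
    by (simp add: w_def[of r] exp_minus field_simps)
  also have "\<dots> \<le> 1/2 * w r"
    using k(2) by (rule mult_right_mono) (simp add: w_def)
  finally have "w t \<le> 0" using max[OF t] by simp
  then show ?thesis by (simp add: w_def mult_le_0_iff not_le)
qed


section \<open>Concave functions and their gradients\<close>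

lemma GDERIV_unique: "GDERIV F z :> a \<Longrightarrow> GDERIV F z :> b \<Longrightarrow> a = b"
  unfolding gderiv_def by (drule (1) has_derivative_unique) (metis vector_eq_rdot inner_commute)

lemma GDERIV_imp_directional_limit:
  assumes "GDERIV F z :> g"
  shows "((\<lambda>e. (F (z + e *\<^sub>R d) - F z) / e) \<longlongrightarrow> d \<bullet> g) (at 0)"
proof -
  have *: "(F has_derivative (\<lambda>h. h \<bullet> g)) (at (z + 0 *\<^sub>R d))"
    using assms by (simp add: gderiv_def)
  have "((\<lambda>e. z + e *\<^sub>R d) has_derivative (\<lambda>e. e *\<^sub>R d)) (at 0)"
    by (auto intro!: derivative_eq_intros)
  from has_derivative_compose[OF this *]
  have "((\<lambda>e. F (z + e *\<^sub>R d)) has_real_derivative (d \<bullet> g)) (at 0)"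
    by (simp add: has_field_derivative_def mult_commute_abs)
  then show ?thesis
    by (simp add: has_field_derivative_iff)
qed

lemma concave_on_UNIV_segment:
  assumes "concave_on UNIV F" "0 \<le> e" "e \<le> 1"
  shows "(1 - e) * F z + e * F w \<le> F (z + e *\<^sub>R (w - z))"
  using concave_onD[OF assms(1), of e z w] assms by (simp add: algebra_simps)

lemma concave_on_UNIV_le_quotient:
  assumes "concave_on UNIV F" "0 < e" "e \<le> 1"
  shows "F (z + d) - F z \<le> (F (z + e *\<^sub>R d) - F z) / e"
  using concave_on_UNIV_segment[OF assms(1), of e z "z + d"] assms by (simp add: field_simps)

text \<open>Difference quotients along the segment to \<open>w\<close> dominate the full increment;
  their one-sided limit at 0 is the tangent slope.\<close>

lemma concave_on_UNIV_le_tangent: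
  assumes "concave_on UNIV F" "GDERIV F z :> g"
  shows "F w \<le> F z + (w - z) \<bullet> g"
proof -
  have "((\<lambda>e. (F (z + e *\<^sub>R (w - z)) - F z) / e) \<longlongrightarrow> (w - z) \<bullet> g) (at_right 0)"
    using GDERIV_imp_directional_limit[OF assms(2)] by (rule filterlim_mono) (auto simp: at_le)
  moreover have "\<forall>\<^sub>F e in at_right (0::real). F w - F z \<le> (F (z + e *\<^sub>R (w - z)) - F z) / e"
    using eventually_at_right_less[of 0] eventually_at_right[of 0 1 "\<lambda>e. e < 1"]
    by (auto simp: eventually_at_right_field elim!: eventually_mono
        intro!: exI[of _ 1] concave_on_UNIV_le_quotient[OF assms(1), of _ z "w - z", simplified])
  ultimately have "F w - F z \<le> (w - z) \<bullet> g"
    by (rule tendsto_lowerbound) simp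
  then show ?thesis by simp
qed

lemma concave_on_UNIV_quotient_le_tangent:
  assumes "concave_on UNIV F" "GDERIV F z :> g" "0 < e"
  shows "(F (z + e *\<^sub>R d) - F z) / e \<le> d \<bullet> g"
  using concave_on_UNIV_le_tangent[OF assms(1,2), of "z + e *\<^sub>R d"] assms(3)
  by (simp add: divide_le_eq mult.commute)

text \<open>The tangent at the displaced point is evaluated back at \<open>z\<close>. With the
  previous bound it traps the quotient between the gradients at the two ends of the segment.\<close>

lemma concave_on_UNIV_tangent_le_quotient:
  assumes "concave_on UNIV F" "GDERIV F (z + e *\<^sub>R d) :> g" "0 < e"
  shows "d \<bullet> g \<le> (F (z + e *\<^sub>R d) - F z) / e"
  using concave_on_UNIV_le_tangent[OF assms(1,2), of z] assms(3)
  by (simp add: le_divide_eq mult.commute)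

text \<open>For \<open>0 < e \<le> 1\<close> the quotient lies between the increments over the full
  step \<open>d\<close> taken forward and backward, so bounds at three points dominate all
  quotients.\<close>

lemma concave_on_UNIV_abs_quotient_le:
  assumes "concave_on UNIV F" "0 < e" "e \<le> 1"
    and "\<bar>F (z + d)\<bar> \<le> K" "\<bar>F z\<bar> \<le> K" "\<bar>F (z - d)\<bar> \<le> K"
  shows "\<bar>(F (z + e *\<^sub>R d) - F z) / e\<bar> \<le> 2 * K"
proof -
  have "F (z + d) - F z \<le> (F (z + e *\<^sub>R d) - F z) / e"
    by (rule concave_on_UNIV_le_quotient[OF assms(1-3)])
  moreover have "(F (z + e *\<^sub>R d) - F z) / e \<le> F z - F (z - d)"
  proof -
    \<comment> \<open>With this weight, \<open>z\<close> is a convex combination of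
      \<open>z + e *\<^sub>R d\<close> and \<open>z - d\<close>.\<close>
    define l where "l = e / (1 + e)"
    have l: "0 \<le> l" "l \<le> 1" using assms(2) by (auto simp: l_def field_simps)
    have e1: "1 + e \<noteq> 0" using assms(2) by simp
    have "(z + e *\<^sub>R d) + l *\<^sub>R ((z - d) - (z + e *\<^sub>R d)) = z + (e - l * (1 + e)) *\<^sub>R d"
      by (simp add: algebra_simps)
    also have "\<dots> = z" using e1 by (simp add: l_def)
    finally have S: "(z + e *\<^sub>R d) + l *\<^sub>R ((z - d) - (z + e *\<^sub>R d)) = z" .
    have "(1 - l) * F (z + e *\<^sub>R d) + l * F (z - d) \<le> F z"
      using concave_on_UNIV_segment[OF assms(1) l, of "z + e *\<^sub>R d" "z - d"] unfolding S .
    then have "(1 + e) * ((1 - l) * F (z + e *\<^sub>R d) + l * F (z - d)) \<le> (1 + e) * F z"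
      using assms(2) by (intro mult_left_mono) auto
    moreover have "(1 + e) * (1 - l) = 1" "(1 + e) * l = e" using e1 by (auto simp: l_def field_simps)
    ultimately have "F (z + e *\<^sub>R d) + e * F (z - d) \<le> (1 + e) * F z"
      by (simp add: distrib_left mult.assoc[symmetric])
    then show ?thesis using assms(2) by (subst pos_divide_le_eq) (simp_all add: algebra_simps)
  qed
  ultimately show ?thesis using assms(4-6) by linarith
qed

section \<open>Partial gradients of jointly concave functions\<close>

lemma GDERIV_fst:
  assumes "GDERIV F (x, u) :> g"
  shows "GDERIV (\<lambda>x. F (x, u)) x :> fst g"
proof -
  have "((\<lambda>x. (x, u)) has_derivative (\<lambda>h. (h, 0))) (at x)"
    by (auto intro!: derivative_eq_intros)
  from has_derivative_compose[OF this assms[unfolded gderiv_def]]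
  show ?thesis by (simp add: gderiv_def inner_prod_def)
qed

lemma GDERIV_inner_const: "GDERIV (\<lambda>x. x \<bullet> a) z :> a"
  unfolding gderiv_def by (rule bounded_linear_imp_has_derivative) (rule bounded_linear_inner_left)

lemma C1_fun_continuous_on: "C1_fun F \<Longrightarrow> continuous_on UNIV F"
  unfolding C1_fun_def gderiv_def
  by (meson continuous_at_imp_continuous_on has_derivative_continuous)

text \<open>The second argument moves with \<open>n\<close>, so differentiability at the limit point
  alone does not suffice. Concavity traps the quotient between gradients at
  \<open>(x + e n *\<^sub>R y, u' n)\<close> and \<open>(x, u' n)\<close>, and both converge by
  continuity of \<open>G\<close>.\<close>

lemma concave_C1_partial_quotient_tendsto:
  fixes F :: "'a::real_inner \<times> 'b::real_inner \<Rightarrow> real"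
  assumes conc: "concave_on UNIV F" and G: "\<And>z. GDERIV F z :> G z" and cont: "continuous_on UNIV G"
    and u: "u' \<longlonglongrightarrow> u" and e: "e \<longlonglongrightarrow> 0" "\<And>n. 0 < e n"
  shows "(\<lambda>n. (F (x + e n *\<^sub>R y, u' n) - F (x, u' n)) / e n) \<longlonglongrightarrow> y \<bullet> fst (G (x, u))"
proof (rule tendsto_sandwich)
  have eq: "(x + e n *\<^sub>R y, u' n) = (x, u' n) + e n *\<^sub>R (y, 0)" for n by simp
  have in0: "(y, 0) \<bullet> g = y \<bullet> fst g" for g :: "'a \<times> 'b" by (simp add: inner_prod_def)
  show "\<forall>\<^sub>F n in sequentially. y \<bullet> fst (G (x + e n *\<^sub>R y, u' n))
      \<le> (F (x + e n *\<^sub>R y, u' n) - F (x, u' n)) / e n"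
    unfolding eq in0[symmetric]
    by (intro always_eventually allI concave_on_UNIV_tangent_le_quotient[OF conc G e(2)])
  show "\<forall>\<^sub>F n in sequentially. (F (x + e n *\<^sub>R y, u' n) - F (x, u' n)) / e n
      \<le> y \<bullet> fst (G (x, u' n))"
    unfolding eq in0[symmetric]
    by (intro always_eventually allI concave_on_UNIV_quotient_le_tangent[OF conc G e(2)])
  have "(\<lambda>n. x + e n *\<^sub>R y) \<longlonglongrightarrow> x + 0 *\<^sub>R y"
    by (intro tendsto_intros e)
  then have "(\<lambda>n. (x + e n *\<^sub>R y, u' n)) \<longlonglongrightarrow> (x, u)"
    using u by (intro tendsto_Pair) auto
  then have "(\<lambda>n. G (x + e n *\<^sub>R y, u' n)) \<longlonglongrightarrow> G (x, u)"
    by (rule continuous_on_tendsto_compose[OF cont]) auto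
  then show "(\<lambda>n. y \<bullet> fst (G (x + e n *\<^sub>R y, u' n))) \<longlonglongrightarrow> y \<bullet> fst (G (x, u))"
    by (intro tendsto_intros)
  have "(\<lambda>n. (x, u' n)) \<longlonglongrightarrow> (x, u)"
    using u by (intro tendsto_Pair) auto
  then have "(\<lambda>n. G (x, u' n)) \<longlonglongrightarrow> G (x, u)"
    by (rule continuous_on_tendsto_compose[OF cont]) auto
  then show "(\<lambda>n. y \<bullet> fst (G (x, u' n))) \<longlonglongrightarrow> y \<bullet> fst (G (x, u))"
    by (intro tendsto_intros)
qed

text \<open>\<open>u\<close> may lie on the boundary of \<open>U\<close>, where the gradient in the
  second argument need not vanish; maximality along segments inside \<open>U\<close> still makes its
  product with \<open>v - u\<close> nonpositive, so it drops out of the joint tangent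
  inequality.\<close>

lemma concave_le_partial_tangent:
  fixes F :: "'a::real_inner \<times> 'b::real_inner \<Rightarrow> real"
  assumes conc: "concave_on UNIV F" and g: "GDERIV F (x, u) :> g"
    and d: "GDERIV (\<lambda>x. F (x, u)) x :> d"
    and max: "\<And>w. w \<in> U \<Longrightarrow> F (x, w) \<le> F (x, u)" and U: "convex U" "u \<in> U" "v \<in> U"
  shows "F (y, v) \<le> F (x, u) + (y - x) \<bullet> d"
proof -
  have "fst g = d" by (rule GDERIV_unique[OF GDERIV_fst[OF g] d])
  moreover have "(v - u) \<bullet> snd g \<le> 0"
  proof -
    have "((\<lambda>e. (F ((x, u) + e *\<^sub>R (0, v - u)) - F (x, u)) / e) \<longlongrightarrow> (0, v - u) \<bullet> g) (at_right 0)"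
      using GDERIV_imp_directional_limit[OF g] by (rule filterlim_mono) (auto simp: at_le)
    moreover have "\<forall>\<^sub>F e in at_right (0::real). (F ((x, u) + e *\<^sub>R (0, v - u)) - F (x, u)) / e \<le> 0"
    proof -
      have "(F ((x, u) + e *\<^sub>R (0, v - u)) - F (x, u)) / e \<le> 0" if "0 < e" "e < 1" for e
      proof -
        have "(1 - e) *\<^sub>R u + e *\<^sub>R v \<in> U" using U that by (intro convexD) auto
        then have "F (x, u + e *\<^sub>R (v - u)) \<le> F (x, u)" by (intro max) (simp add: algebra_simps)
        with that show ?thesis by (simp add: divide_le_0_iff)
      qed
      then show ?thesis by (auto simp: eventually_at_right_field intro!: exI[of _ 1])
    qed
    ultimately have "(0, v - u) \<bullet> g \<le> 0"
      by (rule tendsto_upperbound) simp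
    then show ?thesis by (simp add: inner_prod_def)
  qed
  ultimately show ?thesis
    using concave_on_UNIV_le_tangent[OF conc g, of "(y, v)"] by (simp add: inner_prod_def)
qed


section \<open>Trajectories, and concavity of the control problem\<close>

locale structured =
  fixes P :: "('n::finite, 'm::finite) control_problem"
  assumes structured: "structured_problem P"
begin

abbreviation "T \<equiv> horizon P"
abbreviation "M \<equiv> time_measure P"
abbreviation "U \<equiv> ctrl_set P"
abbreviation "f \<equiv> run_payoff P"
abbreviation "\<phi> \<equiv> end_payoff P"
abbreviation "x \<equiv> state P"

lemma T_pos: "0 < T" and U_compact: "compact U" and U_convex: "convex U"
  and mat_A: "meas_bdd T (mat_A P)" and mat_B: "meas_bdd T (mat_B P)"
  and con_a: "meas_bdd T (con_a P)" and con_b: "meas_bdd T (con_b P)" and con_c: "meas_bdd T (con_c P)"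
  and f_meas: "(\<lambda>t. f t y v) \<in> borel_measurable M"
  and f_AE: "AE t in M. C1_fun (\<lambda>(y, v). f t y v) \<and> concave_on UNIV (\<lambda>(y, v). f t y v)"
  and end_C1: "C1_fun \<phi>" and end_concave: "concave_on UNIV \<phi>"
  using structured by (auto simp: structured_problem_def elim: eventually_mono)

lemma U_bounded: obtains K where "K \<ge> 0" "\<And>v. v \<in> U \<Longrightarrow> norm v \<le> K"
  using compact_imp_bounded[OF U_compact] unfolding bounded_pos by (metis less_imp_le)

lemma f_bounded:
  obtains K where "\<And>t y v. t \<in> {0..T} \<Longrightarrow> norm y \<le> R \<Longrightarrow> v \<in> U \<Longrightarrow> \<bar>f t y v\<bar> \<le> K"
proof -
  obtain c where c: "c > 0" "\<And>t y v. t \<in> {0..T} \<Longrightarrow> v \<in> U \<Longrightarrow> \<bar>f t y v\<bar> \<le> c * (1 + (norm y)\<^sup>2 + (norm v)\<^sup>2)"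
    using structured unfolding structured_problem_def by metis
  obtain K where K: "K \<ge> 0" "\<And>v. v \<in> U \<Longrightarrow> norm v \<le> K"
    using U_bounded by blast
  show thesis
  proof
    fix t y v assume *: "t \<in> {0..T}" "norm (y :: real^'n) \<le> R" "v \<in> U"
    have "\<bar>f t y v\<bar> \<le> c * (1 + (norm y)\<^sup>2 + (norm v)\<^sup>2)" using * by (intro c)
    also have "\<dots> \<le> c * (1 + R\<^sup>2 + K\<^sup>2)"
      using * K c(1) by (intro mult_left_mono add_mono power_mono) auto
    finally show "\<bar>f t y v\<bar> \<le> c * (1 + R\<^sup>2 + K\<^sup>2)" .
  qed
qed

lemma controls_measurable: "u \<in> controls P \<Longrightarrow> u \<in> borel_measurable M"
  and controls_AE: "u \<in> controls P \<Longrightarrow> AE t in M. u t \<in> U"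
  by (auto simp: controls_def Linf_def)

lemma controlsI:
  assumes "u \<in> borel_measurable M" "AE t in M. u t \<in> U"
  shows "u \<in> controls P"
proof -
  obtain K where "\<And>v. v \<in> U \<Longrightarrow> norm v \<le> K" using U_bounded by blast
  then have "AE t in M. norm (u t) \<le> K" using assms(2) by (auto elim: eventually_mono)
  with assms show ?thesis by (auto simp: controls_def Linf_def)
qed

lemma continuous_measurable:
  fixes y :: "real \<Rightarrow> 'a::euclidean_space"
  shows "continuous_on {0..T} y \<Longrightarrow> y \<in> borel_measurable M"
  by (rule continuous_imp_measurable_on_sets_lebesgue) auto

lemma continuous_norm_bounded:
  fixes y :: "real \<Rightarrow> 'a::euclidean_space"
  assumes "continuous_on {0..T} y"
  shows "\<exists>K. \<forall>t\<in>{0..T}. norm (y t) \<le> K"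
proof -
  have "bounded (y ` {0..T})"
    using assms by (intro compact_imp_bounded compact_continuous_image) auto
  then show ?thesis unfolding bounded_iff by blast
qed

lemma meas_bddD:
  assumes "meas_bdd T F"
  shows "F \<in> borel_measurable M" "\<exists>K\<ge>0. \<forall>t\<in>{0..T}. norm (F t) \<le> K"
  using assms unfolding meas_bdd_def bounded_pos by (auto intro: less_imp_le)

lemma matrix_control_bounded:
  assumes u: "u \<in> controls P"
  shows "(\<lambda>t. mat_B P t *v u t) \<in> borel_measurable M"
    and "\<exists>K. AE t in M. norm (mat_B P t *v u t) \<le> K"
proof -
  show "(\<lambda>t. mat_B P t *v u t) \<in> borel_measurable M"
    using controls_measurable[OF u] meas_bddD(1)[OF mat_B] by measurable
  obtain K where K: "K \<ge> 0" "\<And>t v. t \<in> {0..T} \<Longrightarrow> norm (mat_B P t *v v) \<le> K * norm v"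
    using mat_B norm_matrix_vector_mult_le unfolding meas_bdd_def by metis
  obtain L where L: "\<And>v. v \<in> U \<Longrightarrow> norm v \<le> L" using U_bounded by blast
  have "AE t in M. t \<in> {0..T}" by (rule AE_I2) simp
  with controls_AE[OF u] have "AE t in M. norm (mat_B P t *v u t) \<le> K * L"
  proof eventually_elim
    case (elim t)
    show ?case
      using K(2)[OF elim(2), of "u t"] mult_left_mono[OF L[OF elim(1)] K(1)] by linarith
  qed
  then show "\<exists>K. AE t in M. norm (mat_B P t *v u t) \<le> K" ..
qed

lemma matrix_state_bounded:
  assumes A: "meas_bdd T (A :: real \<Rightarrow> real^'n^'n)" and y: "continuous_on {0..T} y"
  shows "(\<lambda>t. A t *v y t) \<in> borel_measurable M"
    and "\<exists>K. \<forall>t\<in>{0..T}. norm (A t *v y t) \<le> K"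
proof -
  show "(\<lambda>t. A t *v y t) \<in> borel_measurable M"
    using continuous_measurable[OF y] meas_bddD(1)[OF A] by measurable
  obtain K where K: "K \<ge> 0" "\<And>t v. t \<in> {0..T} \<Longrightarrow> norm (A t *v v) \<le> K * norm v"
    using A norm_matrix_vector_mult_le unfolding meas_bdd_def by metis
  obtain L where L: "\<And>t. t \<in> {0..T} \<Longrightarrow> norm (y t) \<le> L"
    using continuous_norm_bounded[OF y] by blast
  show "\<exists>K. \<forall>t\<in>{0..T}. norm (A t *v y t) \<le> K"
    using K(2) mult_left_mono[OF L K(1)] by (intro exI[of _ "K * L"]) (meson order_trans)
qed

text \<open>Existence of a solution makes the choice in \<open>state\<close> a genuine
  trajectory.\<close>

lemma state_trajectory:
  assumes u: "u \<in> controls P"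
  shows "is_trajectory P u (x u)"
proof -
  obtain K where K: "AE t in M. norm (mat_B P t *v u t) \<le> K"
    using matrix_control_bounded(2)[OF u] by blast
  have i: "integrable M (\<lambda>t. mat_B P t *v u t)"
    by (rule integrable_bounded_on_ivl[OF matrix_control_bounded(1)[OF u] K])
  obtain y where y: "W11_deriv T y (\<lambda>t. mat_A P t *v y t + mat_B P t *v u t)" "y 0 = x_init P"
    using linear_ivp_exists[OF mat_A i, of 0 "x_init P"] T_pos by auto
  note c = W11_deriv_continuous[OF y(1)]
  obtain L where L: "\<And>t. t \<in> {0..T} \<Longrightarrow> norm (mat_A P t *v y t) \<le> L"
    using matrix_state_bounded(2)[OF mat_A c] by blast
  have "AE t in M. t \<in> {0..T}" by (rule AE_I2) simp
  \<comment> \<open>\<open>is_trajectory\<close> also asks for an essentially bounded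
    derivative.\<close>
  with K have "AE t in M. norm (mat_A P t *v y t + mat_B P t *v u t) \<le> L + K"
    by eventually_elim (use L norm_triangle_le add_mono in blast)
  then have "(\<lambda>t. mat_A P t *v y t + mat_B P t *v u t) \<in> Linf T"
    using matrix_state_bounded(1)[OF mat_A c] matrix_control_bounded(1)[OF u]
    by (auto simp: Linf_def)
  with y have "is_trajectory P u y"
    unfolding is_trajectory_def by auto
  then show ?thesis unfolding state_def by (rule someI[of "is_trajectory P u" y])
qed

lemma state_deriv:
  assumes u: "u \<in> controls P"
  shows "W11_deriv T (x u) (\<lambda>t. mat_A P t *v x u t + mat_B P t *v u t)" and "x u 0 = x_init P"
proof -
  from state_trajectory[OF u] obtain dx where dx: "W11_deriv T (x u) dx"
      "AE t in M. dx t = mat_A P t *v x u t + mat_B P t *v u t"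
    and x0: "x u 0 = x_init P"
    unfolding is_trajectory_def by blast
  show "x u 0 = x_init P" by (rule x0)
  show "W11_deriv T (x u) (\<lambda>t. mat_A P t *v x u t + mat_B P t *v u t)"
    by (rule W11_deriv_cong_AE[OF dx])
      (intro borel_measurable_add matrix_control_bounded[OF u]
        matrix_state_bounded[OF mat_A W11_deriv_continuous[OF dx(1)]])
qed

lemma state_continuous: "u \<in> controls P \<Longrightarrow> continuous_on {0..T} (x u)"
  by (rule W11_deriv_continuous[OF state_deriv(1)])

lemma state_diff_deriv:
  assumes "u \<in> controls P" "v \<in> controls P"
  shows "W11_deriv T (\<lambda>t. x v t - x u t)
    (\<lambda>t. mat_A P t *v (x v t - x u t) + mat_B P t *v (v t - u t))"
  using W11_deriv_diff[OF state_deriv(1)[OF assms(2)] state_deriv(1)[OF assms(1)]]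
  by (simp add: matrix_vector_mult_diff_distrib algebra_simps)

text \<open>The difference of two solutions solves the homogeneous equation with zero initial value.
  Agreement is restricted to the horizon because \<open>state\<close> is arbitrary outside
  it.\<close>

lemma state_eqI:
  assumes u: "u \<in> controls P" and t: "t \<in> {0..T}"
    and y: "W11_deriv T y (\<lambda>t. mat_A P t *v y t + mat_B P t *v u t)" "y 0 = x_init P"
  shows "x u t = y t"
proof -
  have "W11_deriv T (\<lambda>t. x u t - y t) (\<lambda>t. mat_A P t *v (x u t - y t))"
    using W11_deriv_diff[OF state_deriv(1)[OF u] y(1)]
    by (simp add: matrix_vector_mult_diff_distrib algebra_simps)
  from linear_ivp_unique[OF mat_A this _ t] show ?thesis
    using state_deriv(2)[OF u] y(2) by simp
qed

section \<open>Convex combinations of controls and their trajectories\<close>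

lemma controls_segment:
  assumes u: "u \<in> controls P" and v: "v \<in> controls P" and e: "0 \<le> e" "e \<le> 1"
  shows "(\<lambda>t. u t + e *\<^sub>R (v t - u t)) \<in> controls P"
proof (rule controlsI)
  show "(\<lambda>t. u t + e *\<^sub>R (v t - u t)) \<in> borel_measurable M"
    using controls_measurable[OF u] controls_measurable[OF v] by measurable
  show "AE t in M. u t + e *\<^sub>R (v t - u t) \<in> U"
    using controls_AE[OF u] controls_AE[OF v]
  proof eventually_elim
    case (elim t)
    then have "(1 - e) *\<^sub>R u t + e *\<^sub>R v t \<in> U"
      using U_convex e by (intro convexD) auto
    then show ?case by (simp add: algebra_simps)
  qed
qed

text \<open>By uniqueness it is enough that the combined trajectory solves the equation for the
  combined control, which is linearity of the dynamics.\<close>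

lemma state_segment:
  assumes u: "u \<in> controls P" and v: "v \<in> controls P" and e: "0 \<le> e" "e \<le> 1" and t: "t \<in> {0..T}"
  shows "x (\<lambda>t. u t + e *\<^sub>R (v t - u t)) t = x u t + e *\<^sub>R (x v t - x u t)"
proof (rule state_eqI[OF controls_segment[OF u v e] t])
  show "W11_deriv T (\<lambda>t. x u t + e *\<^sub>R (x v t - x u t))
     (\<lambda>t. mat_A P t *v (x u t + e *\<^sub>R (x v t - x u t)) + mat_B P t *v (u t + e *\<^sub>R (v t - u t)))"
    using W11_deriv_add[OF state_deriv(1)[OF u] W11_deriv_scaleR[OF state_diff_deriv[OF u v], of e]]
    by (simp add: matrix_vector_right_distrib matrix_vector_mult_scaleR algebra_simps)
  show "x u 0 + e *\<^sub>R (x v 0 - x u 0) = x_init P"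
    using state_deriv(2)[OF u] state_deriv(2)[OF v] by simp
qed

section \<open>Integrability of the payoff and constraint integrands\<close>

lemma run_payoff_measurable:
  assumes y: "continuous_on {0..T} y" and u: "u \<in> borel_measurable M"
  shows "(\<lambda>t. f t (y t) (u t)) \<in> borel_measurable M"
proof -
  have "(\<lambda>t. (\<lambda>(y, v). f t y v) (y t, u t)) \<in> borel_measurable M"
  proof (rule measurable_Caratheodory[where F="\<lambda>t (y, v). f t y v"])
    show "(\<lambda>t. case z of (y, v) \<Rightarrow> f t y v) \<in> borel_measurable M" for z
      using f_meas by (cases z) simp
    show "AE t in M. continuous_on UNIV (\<lambda>(y, v). f t y v)"
      using f_AE by eventually_elim (auto intro: C1_fun_continuous_on)
    show "(\<lambda>t. (y t, u t)) \<in> borel_measurable M"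
      using continuous_measurable[OF y] u by measurable
  qed simp
  then show ?thesis by simp
qed

lemma run_payoff_bounded:
  assumes y: "continuous_on {0..T} y"
  obtains K where "\<And>t v. t \<in> {0..T} \<Longrightarrow> v \<in> U \<Longrightarrow> \<bar>f t (y t) v\<bar> \<le> K"
proof -
  obtain R where R: "\<And>t. t \<in> {0..T} \<Longrightarrow> norm (y t) \<le> R"
    using continuous_norm_bounded[OF y] by blast
  obtain K where "\<And>t y v. t \<in> {0..T} \<Longrightarrow> norm y \<le> R \<Longrightarrow> v \<in> U \<Longrightarrow> \<bar>f t y v\<bar> \<le> K"
    using f_bounded by blast
  with R show thesis using that by blast
qed

lemma run_payoff_integrable:
  assumes y: "continuous_on {0..T} y" and u: "u \<in> controls P"
  shows "integrable M (\<lambda>t. f t (y t) (u t))"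
proof -
  obtain K where K: "\<And>t v. t \<in> {0..T} \<Longrightarrow> v \<in> U \<Longrightarrow> \<bar>f t (y t) v\<bar> \<le> K"
    using run_payoff_bounded[OF y] by blast
  have "AE t in M. t \<in> {0..T}" by (rule AE_I2) simp
  with controls_AE[OF u] have "AE t in M. norm (f t (y t) (u t)) \<le> K"
    by eventually_elim (use K in auto)
  with run_payoff_measurable[OF y controls_measurable[OF u]] show ?thesis
    by (rule integrable_bounded_on_ivl)
qed

lemma con_h_integrable:
  assumes y: "continuous_on {0..T} y" and u: "u \<in> controls P"
  shows "integrable M (\<lambda>t. con_h P t (y t) (u t))"
proof -
  obtain R where R: "\<And>t. t \<in> {0..T} \<Longrightarrow> norm (y t) \<le> R"
    using continuous_norm_bounded[OF y] by blast
  obtain L where L: "\<And>v. v \<in> U \<Longrightarrow> norm v \<le> L" using U_bounded by blast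
  obtain Ka where Ka: "Ka \<ge> 0" "\<And>t. t \<in> {0..T} \<Longrightarrow> norm (con_a P t) \<le> Ka"
    using meas_bddD(2)[OF con_a] by blast
  obtain Kb where Kb: "Kb \<ge> 0" "\<And>t. t \<in> {0..T} \<Longrightarrow> norm (con_b P t) \<le> Kb"
    using meas_bddD(2)[OF con_b] by blast
  obtain Kc where Kc: "Kc \<ge> 0" "\<And>t. t \<in> {0..T} \<Longrightarrow> norm (con_c P t) \<le> Kc"
    using meas_bddD(2)[OF con_c] by blast
  have "AE t in M. t \<in> {0..T}" by (rule AE_I2) simp
  with controls_AE[OF u] have "AE t in M. norm (con_h P t (y t) (u t)) \<le> Ka * R + Kb * L + Kc"
  proof eventually_elim
    case (elim t)
    have "\<bar>con_a P t \<bullet> y t\<bar> \<le> Ka * R"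
      using Cauchy_Schwarz_ineq2[of "con_a P t" "y t"] mult_mono[OF Ka(2) R Ka(1), OF elim(2,2)]
      by simp
    moreover have "\<bar>con_b P t \<bullet> u t\<bar> \<le> Kb * L"
      using Cauchy_Schwarz_ineq2[of "con_b P t" "u t"] mult_mono[OF Kb(2) L Kb(1), OF elim(2,1)]
      by simp
    ultimately show ?case using Kc(2)[OF elim(2)] by (simp add: con_h_def)
  qed
  moreover have "(\<lambda>t. con_h P t (y t) (u t)) \<in> borel_measurable M"
    unfolding con_h_def
    using continuous_measurable[OF y] controls_measurable[OF u] meas_bddD(1)[OF con_a]
      meas_bddD(1)[OF con_b] meas_bddD(1)[OF con_c] by measurable
  ultimately show ?thesis by (intro integrable_bounded_on_ivl)
qed

section \<open>The affine constraint and the concave payoff along segments of controls\<close>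

lemma integral_time_cong:
  assumes "\<And>t. t \<in> {0..T} \<Longrightarrow> F t = G t"
  shows "integral\<^sup>L M F = integral\<^sup>L M G"
  using assms by (intro Bochner_Integration.integral_cong) auto

lemma constraint_segment:
  assumes u: "u \<in> controls P" and v: "v \<in> controls P" and e: "0 \<le> e" "e \<le> 1"
  shows "constraint P (\<lambda>t. u t + e *\<^sub>R (v t - u t))
    = constraint P u + e * (constraint P v - constraint P u)"
proof -
  have iu: "integrable M (\<lambda>t. con_h P t (x u t) (u t))" and iv: "integrable M (\<lambda>t. con_h P t (x v t) (v t))"
    using u v by (auto intro: con_h_integrable state_continuous)
  have "constraint P (\<lambda>t. u t + e *\<^sub>R (v t - u t))
    = (LINT t|M. con_h P t (x u t) (u t) + e * (con_h P t (x v t) (v t) - con_h P t (x u t) (u t)))"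
    unfolding constraint_def
  proof (rule integral_time_cong)
    fix t assume t: "t \<in> {0..T}"
    show "con_h P t (x (\<lambda>t. u t + e *\<^sub>R (v t - u t)) t) (u t + e *\<^sub>R (v t - u t))
        = con_h P t (x u t) (u t) + e * (con_h P t (x v t) (v t) - con_h P t (x u t) (u t))"
      unfolding state_segment[OF u v e t] by (simp add: con_h_def algebra_simps)
  qed
  also have "\<dots> = constraint P u + e * (constraint P v - constraint P u)"
    using iu iv by (simp add: constraint_def)
  finally show ?thesis .
qed

lemma payoff_segment:
  assumes u: "u \<in> controls P" and v: "v \<in> controls P" and e: "0 \<le> e" "e \<le> 1"
  shows "payoff P u + e * (payoff P v - payoff P u) \<le> payoff P (\<lambda>t. u t + e *\<^sub>R (v t - u t))"
proof -
  note w = controls_segment[OF u v e]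
  have iu: "integrable M (\<lambda>t. f t (x u t) (u t))" and iv: "integrable M (\<lambda>t. f t (x v t) (v t))"
    using u v by (auto intro: run_payoff_integrable state_continuous)
  let ?w = "\<lambda>t. u t + e *\<^sub>R (v t - u t)"
  have iw: "integrable M (\<lambda>t. f t (x ?w t) (?w t))"
    using w by (intro run_payoff_integrable state_continuous)
  have "(LINT t|M. f t (x u t) (u t) + e * (f t (x v t) (v t) - f t (x u t) (u t)))
      \<le> (LINT t|M. f t (x ?w t) (?w t))"
  proof (rule integral_mono_AE)
    have "AE t in M. t \<in> {0..T}" by (rule AE_I2) simp
    with f_AE show "AE t in M. f t (x u t) (u t) + e * (f t (x v t) (v t) - f t (x u t) (u t))
        \<le> f t (x ?w t) (?w t)"
    proof eventually_elim
      case (elim t)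
      show ?case
        using concave_on_UNIV_segment[OF conjunct2[OF elim(1)] e, of "(x u t, u t)" "(x v t, v t)"]
        unfolding state_segment[OF u v e elim(2)] by (simp add: algebra_simps)
    qed
  qed (use iu iv iw in auto)
  moreover have "\<phi> (x u T) + e * (\<phi> (x v T) - \<phi> (x u T)) \<le> \<phi> (x ?w T)"
    using concave_on_UNIV_segment[OF end_concave e, of "x u T" "x v T"] state_segment[OF u v e, of T] T_pos
    by (simp add: left_diff_distrib right_diff_distrib)
  ultimately show ?thesis
    using iu iv by (simp add: payoff_def algebra_simps)
qed

section \<open>Duality and sufficiency of the maximum principle\<close>

lemma optimal_control_iff:
  "optimal_control P b u \<longleftrightarrow> u \<in> controls P \<and> constraint P u = b \<and>
     (\<forall>v\<in>controls P. constraint P v = b \<longrightarrow> payoff P v \<le> payoff P u)"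
proof -
  have "ereal (payoff P u) = value_fun P b \<longleftrightarrow> (\<forall>v\<in>controls P. constraint P v = b \<longrightarrow> payoff P v \<le> payoff P u)"
    if "u \<in> controls P" "constraint P u = b"
  proof
    assume "ereal (payoff P u) = value_fun P b"
    then have "ereal (payoff P v) \<le> ereal (payoff P u)" if "v \<in> controls P" "constraint P v = b" for v
      unfolding value_fun_def using that by (auto intro: SUP_upper)
    then show "\<forall>v\<in>controls P. constraint P v = b \<longrightarrow> payoff P v \<le> payoff P u" by simp
  next
    assume *: "\<forall>v\<in>controls P. constraint P v = b \<longrightarrow> payoff P v \<le> payoff P u"
    show "ereal (payoff P u) = value_fun P b"
      unfolding value_fun_def using that *
      by (intro antisym SUP_least SUP_upper) auto
  qed
  then show ?thesis unfolding optimal_control_def by blast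
qed

lemma interior_value_dom:
  assumes "b \<in> interior (value_dom P)"
  obtains u1 u2 where "u1 \<in> controls P" "u2 \<in> controls P" "constraint P u1 < b" "b < constraint P u2"
proof -
  obtain e where e: "e > 0" "cball b e \<subseteq> value_dom P"
    using assms unfolding mem_interior_cball by blast
  then have "b - e \<in> constraint P ` controls P" "b + e \<in> constraint P ` controls P"
    unfolding value_dom_eq by (auto simp: subset_iff dist_real_def)
  then obtain u1 u2 where "u1 \<in> controls P" "u2 \<in> controls P" "constraint P u1 = b - e" "constraint P u2 = b + e"
    by (auto simp: image_iff)
  with that[of u1 u2] e(1) show thesis by simp
qed

text \<open>Each control below level \<open>b\<close> bounds the multiplier from below, and each
  control above \<open>b\<close> bounds it from above. Concavity makes the two families compatible,
  and a number between them is minus a supergradient of the value function at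
  \<open>b\<close>.\<close>

lemma lagrange_multiplier_exists:
  assumes b: "b \<in> interior (value_dom P)" and opt: "optimal_control P b u"
  obtains \<mu> where "\<And>v. v \<in> controls P \<Longrightarrow> payoff P v + \<mu> * (constraint P v - b) \<le> payoff P u"
proof -
  obtain u1 u2 where u12: "u1 \<in> controls P" "u2 \<in> controls P" "constraint P u1 < b" "b < constraint P u2"
    using interior_value_dom[OF b] by blast
  \<comment> \<open>These are the lower bounds; their supremum will be the multiplier.\<close>
  define S where "S = {(payoff P v - payoff P u) / (b - constraint P v) |v. v \<in> controls P \<and> constraint P v < b}"
  have slope: "s \<le> (payoff P u - payoff P v2) / (constraint P v2 - b)"
    if s: "s \<in> S" and v2: "v2 \<in> controls P" "b < constraint P v2" for s v2
  proof -
    obtain v1 where v1: "v1 \<in> controls P" "constraint P v1 < b"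
      and s_eq: "s = (payoff P v1 - payoff P u) / (b - constraint P v1)"
      using s unfolding S_def by blast
    define d1 d2 where "d1 = b - constraint P v1" and "d2 = constraint P v2 - b"
    \<comment> \<open>This weight puts the mixture of \<open>v1\<close> and \<open>v2\<close>
      exactly at level \<open>b\<close>, where \<open>u\<close> is optimal.\<close>
    define e where "e = d1 / (d1 + d2)"
    have d: "d1 > 0" "d2 > 0" using v1 v2 by (auto simp: d1_def d2_def)
    then have e: "0 \<le> e" "e \<le> 1" by (auto simp: e_def)
    let ?w = "\<lambda>t. v1 t + e *\<^sub>R (v2 t - v1 t)"
    have "constraint P ?w = constraint P v1 + e * (d1 + d2)"
      by (simp add: constraint_segment[OF v1(1) v2(1) e] d1_def d2_def)
    also have "\<dots> = b" using d by (simp add: e_def d1_def)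
    finally have "payoff P ?w \<le> payoff P u"
      using opt controls_segment[OF v1(1) v2(1) e] by (auto simp: optimal_control_iff)
    then have "payoff P v1 + e * (payoff P v2 - payoff P v1) \<le> payoff P u"
      using payoff_segment[OF v1(1) v2(1) e] by linarith
    then have "(d1 + d2) * (payoff P v1 + e * (payoff P v2 - payoff P v1)) \<le> (d1 + d2) * payoff P u"
      using d by (intro mult_left_mono) auto
    moreover have "(d1 + d2) * (payoff P v1 + e * (payoff P v2 - payoff P v1))
        = (d1 + d2) * payoff P v1 + d1 * (payoff P v2 - payoff P v1)"
      using d by (simp add: e_def distrib_left)
    ultimately have "d2 * (payoff P v1 - payoff P u) \<le> d1 * (payoff P u - payoff P v2)"
      by (simp add: algebra_simps)
    then have "(payoff P v1 - payoff P u) / d1 \<le> (payoff P u - payoff P v2) / d2"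
      using d by (simp add: divide_le_eq le_divide_eq mult.commute)
    then show ?thesis unfolding s_eq d1_def d2_def .
  qed
  \<comment> \<open>Interiority of \<open>b\<close> supplies a control on either side:
    \<open>u1\<close> makes \<open>S\<close> nonempty and the slope towards \<open>u2\<close> bounds
    it.\<close>
  have ne: "S \<noteq> {}" using u12 unfolding S_def by blast
  have bdd: "bdd_above S" using slope u12 by (intro bdd_aboveI) blast
  show thesis
  proof
    fix v assume v: "v \<in> controls P"
    consider "constraint P v < b" | "constraint P v = b" | "b < constraint P v" by linarith
    then show "payoff P v + Sup S * (constraint P v - b) \<le> payoff P u"
    proof cases
      case 1
      then have "(payoff P v - payoff P u) / (b - constraint P v) \<le> Sup S"
        using v by (intro cSup_upper bdd) (auto simp: S_def)
      with 1 have "payoff P v - payoff P u \<le> Sup S * (b - constraint P v)"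
        by (simp add: pos_divide_le_eq)
      then show ?thesis by (simp add: algebra_simps)
    next
      case 2
      then show ?thesis using opt v by (auto simp: optimal_control_iff)
    next
      case 3
      then have "Sup S \<le> (payoff P u - payoff P v) / (constraint P v - b)"
        using v by (intro cSup_least ne slope)
      with 3 have "Sup S * (constraint P v - b) \<le> payoff P u - payoff P v"
        by (simp add: pos_le_divide_eq)
      then show ?thesis by simp
    qed
  qed
qed

text \<open>Weak duality: inserting \<open>u\<close> into the supremum bounds every dual value below
  by its payoff, and by hypothesis \<mu> attains this bound.\<close>

lemma dual_optimalI:
  assumes u: "u \<in> controls P" "constraint P u = b"
    and le: "\<And>v. v \<in> controls P \<Longrightarrow> payoff P v + \<mu> * (constraint P v - b) \<le> payoff P u"
  shows "\<mu> \<in> dual_optimal P b"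
proof -
  have lower: "ereal (payoff P u) \<le> dual_fun P \<nu> - ereal (\<nu> * b)" for \<nu>
  proof -
    have "ereal (payoff P u + \<nu> * b) \<le> dual_fun P \<nu>"
      unfolding dual_fun_def using u by (intro SUP_upper2[of u]) auto
    then have "ereal (payoff P u + \<nu> * b) - ereal (\<nu> * b) \<le> dual_fun P \<nu> - ereal (\<nu> * b)"
      by (intro ereal_minus_mono) auto
    then show ?thesis by simp
  qed
  have "dual_fun P \<mu> \<le> ereal (payoff P u + \<mu> * b)"
    unfolding dual_fun_def using le by (intro SUP_least) (simp add: algebra_simps)
  then have "dual_fun P \<mu> - ereal (\<mu> * b) \<le> ereal (payoff P u + \<mu> * b) - ereal (\<mu> * b)"
    by (intro ereal_minus_mono) auto
  then have "dual_fun P \<mu> - ereal (\<mu> * b) \<le> ereal (payoff P u)"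
    by simp
  with lower show ?thesis
    by (auto simp: dual_optimal_def is_arg_min_def not_less intro: order_trans)
qed

text \<open>Strong duality: a Lagrange multiplier \<nu> brings the dual value down to the payoff of
  \<open>u\<close>, so a dual minimizer \<mu> does so too, and its supremum bounds the value at each
  \<open>v\<close>.\<close>

lemma dual_optimalD:
  assumes b: "b \<in> interior (value_dom P)" and opt: "optimal_control P b u"
    and \<mu>: "\<mu> \<in> dual_optimal P b" and v: "v \<in> controls P"
  shows "payoff P v + \<mu> * (constraint P v - b) \<le> payoff P u"
proof -
  obtain \<nu> where \<nu>: "\<And>v. v \<in> controls P \<Longrightarrow> payoff P v + \<nu> * (constraint P v - b) \<le> payoff P u"
    using lagrange_multiplier_exists[OF b opt] by blast
  have "dual_fun P \<nu> \<le> ereal (payoff P u + \<nu> * b)"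
    unfolding dual_fun_def using \<nu> by (intro SUP_least) (simp add: algebra_simps)
  then have "dual_fun P \<nu> - ereal (\<nu> * b) \<le> ereal (payoff P u + \<nu> * b) - ereal (\<nu> * b)"
    by (intro ereal_minus_mono) auto
  moreover have "dual_fun P \<mu> - ereal (\<mu> * b) \<le> dual_fun P \<nu> - ereal (\<nu> * b)"
    using \<mu> by (auto simp: dual_optimal_def is_arg_min_def not_less)
  moreover have "ereal (payoff P v + \<mu> * constraint P v) \<le> dual_fun P \<mu>"
    unfolding dual_fun_def using v by (intro SUP_upper)
  then have "ereal (payoff P v + \<mu> * constraint P v) - ereal (\<mu> * b) \<le> dual_fun P \<mu> - ereal (\<mu> * b)"
    by (intro ereal_minus_mono) auto
  ultimately have "ereal (payoff P v + \<mu> * constraint P v) - ereal (\<mu> * b) \<le> ereal (payoff P u + \<nu> * b) - ereal (\<nu> * b)"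
    by (meson order_trans)
  then show ?thesis by (simp add: algebra_simps)
qed

section \<open>The Hamiltonian as the running payoff plus an affine function of state and
  control\<close>

lemma hamiltonian_eq:
  "hamiltonian P t y v p \<mu> = f t y v + y \<bullet> (p v* mat_A P t + \<mu> *\<^sub>R con_a P t)
     + v \<bullet> (p v* mat_B P t + \<mu> *\<^sub>R con_b P t) + \<mu> * con_c P t"
proof -
  have "p \<bullet> (mat_A P t *v y) = y \<bullet> (p v* mat_A P t)" "p \<bullet> (mat_B P t *v v) = v \<bullet> (p v* mat_B P t)"
    by (metis dot_lmul_matrix inner_commute)+
  then show ?thesis
    by (simp add: hamiltonian_def con_h_def inner_add_right algebra_simps inner_commute)
qed

lemma concave_on_hamiltonian:
  assumes "concave_on UNIV (\<lambda>(y, v). f t y v)"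
  shows "concave_on UNIV (\<lambda>(y, v). hamiltonian P t y v p \<mu>)"
proof -
  have aff: "concave_on UNIV (\<lambda>z. z \<bullet> c + d)" for c :: "(real^'n) \<times> (real^'m)" and d
    by (auto simp: concave_on_iff algebra_simps) (simp add: distrib_right[symmetric] ring_distribs)
  from concave_on_add[OF assms aff[of "(p v* mat_A P t + \<mu> *\<^sub>R con_a P t, p v* mat_B P t + \<mu> *\<^sub>R con_b P t)"
      "\<mu> * con_c P t"]] show ?thesis
    by (simp add: hamiltonian_eq case_prod_unfold inner_prod_def add.assoc)
qed

lemma GDERIV_hamiltonian:
  assumes "GDERIV (\<lambda>(y, v). f t y v) (y, v) :> g"
  shows "GDERIV (\<lambda>(y, v). hamiltonian P t y v p \<mu>) (y, v) :>
     g + (p v* mat_A P t + \<mu> *\<^sub>R con_a P t, p v* mat_B P t + \<mu> *\<^sub>R con_b P t)"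
  using GDERIV_add[OF GDERIV_add[OF assms GDERIV_inner_const] GDERIV_const[of "\<mu> * con_c P t"],
      of "(p v* mat_A P t + \<mu> *\<^sub>R con_a P t, p v* mat_B P t + \<mu> *\<^sub>R con_b P t)"]
  by (simp add: hamiltonian_eq case_prod_unfold inner_prod_def add.assoc)

lemma end_GDERIV: obtains g where "GDERIV \<phi> z :> g"
  using end_C1 unfolding C1_fun_def by blast

text \<open>Trajectories share their initial state, so integrating the derivative of
  \<open>p \<bullet> y\<close> leaves a boundary term only at the terminal time; the condition on
  \<open>p T\<close> cancels it against the tangent bound for the end payoff.\<close>

lemma pontryagin_imp_maximizes_lagrangian:
  assumes u: "u \<in> controls P" and pm: "pontryagin_multiplier P u \<mu>" and v: "v \<in> controls P"
  shows "payoff P v + \<mu> * constraint P v \<le> payoff P u + \<mu> * constraint P u"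
proof -
  obtain p dp where p: "W11_deriv T p dp"
    and ae: "AE t in M. (GDERIV (\<lambda>y. hamiltonian P t y (u t) (p t) \<mu>) (x u t) :> - dp t) \<and>
           is_arg_max (\<lambda>v. hamiltonian P t (x u t) v (p t) \<mu>) (\<lambda>v. v \<in> U) (u t)"
    and pT: "GDERIV \<phi> (x u T) :> p T"
    using pm unfolding pontryagin_multiplier_def by blast
  define y where "y t = x v t - x u t" for t
  define dy where "dy t = mat_A P t *v (x v t - x u t) + mat_B P t *v (v t - u t)" for t
  have y: "W11_deriv T y dy"
    unfolding y_def dy_def by (rule state_diff_deriv[OF u v])
  have y0: "y 0 = 0" using state_deriv(2)[OF u] state_deriv(2)[OF v] by (simp add: y_def)
  have ibp: "has_bochner_integral M (\<lambda>t. dp t \<bullet> y t + p t \<bullet> dy t) (p T \<bullet> y T)"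
    using W11_deriv_inner[OF p y] T_pos y0 by simp
  have fu: "integrable M (\<lambda>t. f t (x u t) (u t))" and fv: "integrable M (\<lambda>t. f t (x v t) (v t))"
    and hu: "integrable M (\<lambda>t. con_h P t (x u t) (u t))" and hv: "integrable M (\<lambda>t. con_h P t (x v t) (v t))"
    using u v by (auto intro: run_payoff_integrable con_h_integrable state_continuous)
  have ib: "integrable M (\<lambda>t. - (dp t \<bullet> y t + p t \<bullet> dy t))"
    using ibp by (intro Bochner_Integration.integrable_minus) (simp add: has_bochner_integral_iff)
  have "(LINT t|M. (f t (x v t) (v t) + \<mu> * con_h P t (x v t) (v t))
          - (f t (x u t) (u t) + \<mu> * con_h P t (x u t) (u t)))
      \<le> (LINT t|M. - (dp t \<bullet> y t + p t \<bullet> dy t))"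
  proof (rule integral_mono_AE)
    show "AE t in M. (f t (x v t) (v t) + \<mu> * con_h P t (x v t) (v t))
          - (f t (x u t) (u t) + \<mu> * con_h P t (x u t) (u t)) \<le> - (dp t \<bullet> y t + p t \<bullet> dy t)"
      using ae f_AE controls_AE[OF v]
    proof eventually_elim
      case (elim t)
      obtain g where g: "GDERIV (\<lambda>(y, v). f t y v) (x u t, u t) :> g"
        using elim(2) unfolding C1_fun_def by blast
      \<comment> \<open>A tangent inequality in state and control at once: the maximum condition
        removes the control part, and the adjoint equation identifies the state part.\<close>
      have "hamiltonian P t (x v t) (v t) (p t) \<mu> \<le> hamiltonian P t (x u t) (u t) (p t) \<mu> + y t \<bullet> (- dp t)"
        using concave_le_partial_tangent[OF concave_on_hamiltonian GDERIV_hamiltonian[OF g], of "p t" \<mu> "- dp t" U "v t" "x v t"]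
          elim U_convex
        by (auto simp: is_arg_max_linorder y_def)
      \<comment> \<open>By linearity of the dynamics the adjoint terms of the two Hamiltonians
        differ by \<open>p t \<bullet> dy t\<close>.\<close>
      then show ?case
        by (simp add: hamiltonian_def dy_def y_def inner_add_right inner_diff_right
            matrix_vector_mult_diff_distrib inner_commute algebra_simps)
    qed
  qed (use fu fv hu hv ib in auto)
  also have "\<dots> = - (p T \<bullet> y T)"
    using ibp unfolding has_bochner_integral_iff Bochner_Integration.integral_minus by simp
  finally have "(LINT t|M. f t (x v t) (v t)) + \<mu> * constraint P v
      - ((LINT t|M. f t (x u t) (u t)) + \<mu> * constraint P u) \<le> - (p T \<bullet> y T)"
    using fu fv hu hv by (simp add: constraint_def)
  moreover have "\<phi> (x v T) \<le> \<phi> (x u T) + p T \<bullet> y T"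
    using concave_on_UNIV_le_tangent[OF end_concave pT, of "x v T"] by (simp add: y_def inner_commute)
  ultimately show ?thesis by (simp add: payoff_def)
qed

section \<open>Necessity of the maximum principle\<close>

text \<open>A fixed null sequence in \<open>(0, 1]\<close>: its members are admissible weights for
  convex combinations, and dominated convergence is applied along it.\<close>

definition step :: "nat \<Rightarrow> real" where "step n = inverse (real (Suc n))"

lemma step: "0 < step n" "step n \<le> 1" "step \<longlonglongrightarrow> 0"
  unfolding step_def[abs_def] by (simp, simp add: inverse_le_1_iff, rule LIMSEQ_inverse_real_of_nat)

text \<open>The state gradient along \<open>u\<close> is bounded and measurable as a limit of
  bounded measurable difference quotients. The control moves in the limit as well, since a control
  and its trajectory are perturbed together.\<close>

lemma partial_gradient:
  assumes y: "continuous_on {0..T} y" and u: "u \<in> controls P"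
  obtains g where "g \<in> borel_measurable M" "\<exists>K. AE t in M. norm (g t) \<le> K"
    "AE t in M. GDERIV (\<lambda>z. f t z (u t)) (y t) :> g t"
    "\<forall>v\<in>controls P. \<forall>d. continuous_on {0..T} d \<longrightarrow>
      (\<lambda>n. LINT t|M. (f t (y t + step n *\<^sub>R d t) (u t + step n *\<^sub>R (v t - u t))
          - f t (y t) (u t + step n *\<^sub>R (v t - u t))) / step n)
        \<longlonglongrightarrow> (LINT t|M. d t \<bullet> g t)"
    "\<forall>d. continuous_on {0..T} d \<longrightarrow> integrable M (\<lambda>t. d t \<bullet> g t)"
proof -
  \<comment> \<open>The gradient field is chosen separately at each time, so its measurability in
    \<open>t\<close> is not known from the choice; that of \<open>g\<close> is recovered from the
    quotients.\<close>
  define G where "G t = (SOME G. (\<forall>z. GDERIV (\<lambda>(y, v). f t y v) z :> G z) \<and> continuous_on UNIV G)" for t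
  have G: "AE t in M. (\<forall>z. GDERIV (\<lambda>(y, v). f t y v) z :> G t z) \<and> continuous_on UNIV (G t)"
    using f_AE
  proof eventually_elim
    case (elim t)
    then show ?case
      using someI_ex[OF conjunct1[OF elim, unfolded C1_fun_def]] unfolding G_def by blast
  qed
  define g where "g t = fst (G t (y t, u t))" for t
  define q where "q v d n t = (f t (y t + step n *\<^sub>R d t) (u t + step n *\<^sub>R (v t - u t))
          - f t (y t) (u t + step n *\<^sub>R (v t - u t))) / step n" for v d n t
  have in_T: "AE t in M. t \<in> {0..T}" by (rule AE_I2) simp
  have q_meas: "q v d n \<in> borel_measurable M" if "v \<in> controls P" "continuous_on {0..T} d" for v d n
  proof -
    have "(\<lambda>t. u t + step n *\<^sub>R (v t - u t)) \<in> borel_measurable M"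
      using controls_segment[OF u that(1), of "step n"] step(1,2)[of n] by (intro controls_measurable) auto
    moreover have "continuous_on {0..T} (\<lambda>t. y t + step n *\<^sub>R d t)"
      using that y by (intro continuous_intros)
    ultimately show ?thesis
      unfolding q_def using y by (intro borel_measurable_divide borel_measurable_diff run_payoff_measurable) auto
  qed
  have q_lim: "AE t in M. (\<lambda>n. q v d n t) \<longlonglongrightarrow> d t \<bullet> g t" if "v \<in> controls P" for v d
    using G f_AE
  proof eventually_elim
    case (elim t)
    have "(\<lambda>n. u t + step n *\<^sub>R (v t - u t)) \<longlonglongrightarrow> u t + 0 *\<^sub>R (v t - u t)"
      by (intro tendsto_intros step)
    then have "(\<lambda>n. u t + step n *\<^sub>R (v t - u t)) \<longlonglongrightarrow> u t" by simp
    from concave_C1_partial_quotient_tendsto[where F="\<lambda>(y, v). f t y v" and G="G t" and x="y t" and y="d t",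
        OF _ _ _ this step(3) step(1)]
    show ?case using elim by (simp add: q_def g_def)
  qed
  have q_bd: "\<exists>K. \<forall>n. AE t in M. norm (q v d n t) \<le> K"
    if v: "v \<in> controls P" and d: "continuous_on {0..T} d" for v d
  proof -
    have c: "continuous_on {0..T} (\<lambda>t. y t + d t)" "continuous_on {0..T} (\<lambda>t. y t - d t)"
      using y d by (auto intro: continuous_intros)
    obtain K1 where K1: "\<And>t v. t \<in> {0..T} \<Longrightarrow> v \<in> U \<Longrightarrow> \<bar>f t (y t + d t) v\<bar> \<le> K1"
      using run_payoff_bounded[OF c(1)] by blast
    obtain K2 where K2: "\<And>t v. t \<in> {0..T} \<Longrightarrow> v \<in> U \<Longrightarrow> \<bar>f t (y t - d t) v\<bar> \<le> K2"
      using run_payoff_bounded[OF c(2)] by blast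
    obtain K3 where K3: "\<And>t v. t \<in> {0..T} \<Longrightarrow> v \<in> U \<Longrightarrow> \<bar>f t (y t) v\<bar> \<le> K3"
      using run_payoff_bounded[OF y] by blast
    \<comment> \<open>The growth condition bounds the values at \<open>y t + d t\<close>,
      \<open>y t - d t\<close> and \<open>y t\<close> for controls in \<open>U\<close>; concavity
      lets these three dominate every quotient.\<close>
    define K where "K = max K1 (max K2 K3)"
    have "AE t in M. norm (q v d n t) \<le> 2 * K" for n
    proof -
      have "AE t in M. u t + step n *\<^sub>R (v t - u t) \<in> U"
        using controls_segment[OF u v, of "step n"] step(1,2)[of n] by (intro controls_AE) auto
      with in_T f_AE show ?thesis
      proof eventually_elim
        case (elim t)
        let ?w = "u t + step n *\<^sub>R (v t - u t)"
        show ?case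
          using concave_on_UNIV_abs_quotient_le[OF conjunct2[OF elim(2)] step(1,2)[of n],
              where z="(y t, ?w)" and d="(d t, 0)" and K=K]
            K1[OF elim(1,3)] K2[OF elim(1,3)] K3[OF elim(1,3)]
          by (simp add: q_def K_def)
      qed
    qed
    then show ?thesis by blast
  qed
  \<comment> \<open>With \<open>v = u\<close> the control in the quotient stays put, and the product
    is an almost everywhere limit of measurable functions.\<close>
  have dg_meas: "(\<lambda>t. d t \<bullet> g t) \<in> borel_measurable M" if d: "continuous_on {0..T} d" for d
  proof (rule borel_measurable_AE_lebesgue_on)
    show "(\<lambda>t. lim (\<lambda>n. q u d n t)) \<in> borel_measurable M"
      by (intro borel_measurable_lim_metric q_meas u d)
    show "AE t in M. lim (\<lambda>n. q u d n t) = d t \<bullet> g t"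
      using q_lim[OF u, of d] by eventually_elim (rule limI)
  qed simp
  have dg_bd: "\<exists>K. AE t in M. norm (d t \<bullet> g t) \<le> K" if d: "continuous_on {0..T} d" for d
  proof -
    obtain K where "\<And>n. AE t in M. norm (q u d n t) \<le> K" using q_bd[OF u d] by blast
    then have "AE t in M. \<forall>n. norm (q u d n t) \<le> K" by (simp add: AE_all_countable)
    with q_lim[OF u, of d] have "AE t in M. norm (d t \<bullet> g t) \<le> K"
    proof eventually_elim
      case (elim t)
      show ?case by (rule LIMSEQ_le_const2[OF tendsto_norm[OF elim(1)]]) (use elim(2) in blast)
    qed
    then show ?thesis ..
  qed
  \<comment> \<open>Constant directions \<open>d\<close> recover the components of
    \<open>g\<close>.\<close>
  have g_meas: "g \<in> borel_measurable M"
  proof (subst borel_measurable_euclidean_space, intro ballI)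
    fix b :: "real^'n"
    show "(\<lambda>t. g t \<bullet> b) \<in> borel_measurable M"
      using dg_meas[of "\<lambda>_. b"] by (simp add: inner_commute)
  qed
  have g_bd: "\<exists>K. AE t in M. norm (g t) \<le> K"
  proof -
    have "\<forall>b. \<exists>K. AE t in M. norm (b \<bullet> g t) \<le> K" using dg_bd by auto
    then obtain K where K: "\<And>b. AE t in M. norm (b \<bullet> g t) \<le> K b" by metis
    then have "AE t in M. \<forall>b\<in>Basis. norm (b \<bullet> g t) \<le> K b"
      by (intro AE_finite_allI) auto
    then have "AE t in M. norm (g t) \<le> (\<Sum>b\<in>Basis. K b)"
    proof eventually_elim
      case (elim t)
      have "norm (g t) \<le> (\<Sum>b\<in>Basis. \<bar>g t \<bullet> b\<bar>)" by (rule norm_le_l1)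
      also have "\<dots> \<le> (\<Sum>b\<in>Basis. K b)"
        using elim by (intro sum_mono) (simp add: inner_commute)
      finally show ?case .
    qed
    then show ?thesis ..
  qed
  have g_deriv: "AE t in M. GDERIV (\<lambda>z. f t z (u t)) (y t) :> g t"
    using G
  proof eventually_elim
    case (elim t)
    then show ?case using GDERIV_fst[of "\<lambda>(y, v). f t y v" "y t" "u t"] by (simp add: g_def)
  qed
  have lim: "(\<lambda>n. integral\<^sup>L M (q v d n)) \<longlonglongrightarrow> (LINT t|M. d t \<bullet> g t)"
    if v: "v \<in> controls P" and d: "continuous_on {0..T} d" for v d
  proof -
    obtain K where K: "\<And>n. AE t in M. norm (q v d n t) \<le> K" using q_bd[OF v d] by blast
    show ?thesis
      by (rule integral_dominated_convergence[where w="\<lambda>_. K"])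
        (use K q_lim[OF v] dg_meas[OF d] q_meas[OF v d] in auto)
  qed
  have int: "integrable M (\<lambda>t. d t \<bullet> g t)" if d: "continuous_on {0..T} d" for d
    using dg_bd[OF d] integrable_bounded_on_ivl[OF dg_meas[OF d]] by blast
  show thesis
    using that[OF g_meas g_bd g_deriv] lim int unfolding q_def by simp
qed

text \<open>A linear terminal value problem with matrix \<open>- transpose (mat_A P t)\<close>,
  solved with prescribed time \<open>T\<close>; boundedness of \<open>g\<close> makes its
  inhomogeneity integrable.\<close>

lemma adjoint_exists:
  assumes g: "g \<in> borel_measurable M" "\<exists>K. AE t in M. norm (g t) \<le> K"
  obtains p where "W11_deriv T p (\<lambda>t. - (p t v* mat_A P t) - (g t + \<mu> *\<^sub>R con_a P t))" "p T = c"
proof -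
  have bl: "bounded_linear (\<lambda>A :: real^'n^'n. - transpose A)"
    by (intro linear_conv_bounded_linear[THEN iffD1] linearI)
      (auto simp: transpose_def vec_eq_iff)
  have A: "meas_bdd T (\<lambda>t. - transpose (mat_A P t))"
    unfolding meas_bdd_def
  proof
    show "(\<lambda>t. - transpose (mat_A P t)) \<in> borel_measurable M"
      by (rule borel_measurable_continuous_on[OF linear_continuous_on[OF bl] meas_bddD(1)[OF mat_A]])
    show "bounded ((\<lambda>t. - transpose (mat_A P t)) ` {0..T})"
      using bounded_linear_image[OF _ bl, of "mat_A P ` {0..T}"] mat_A
      by (simp add: meas_bdd_def image_image)
  qed
  obtain K where K: "AE t in M. norm (g t) \<le> K" using g by blast
  obtain Ka where Ka: "\<And>t. t \<in> {0..T} \<Longrightarrow> norm (con_a P t) \<le> Ka"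
    using meas_bddD(2)[OF con_a] by blast
  have ig: "integrable M g" by (rule integrable_bounded_on_ivl[OF g(1) K])
  have ia: "integrable M (con_a P)"
    by (rule integrable_bounded_on_ivl[OF meas_bddD(1)[OF con_a], of Ka]) (auto intro!: AE_I2 Ka)
  have "integrable M (\<lambda>t. - (g t + \<mu> *\<^sub>R con_a P t))"
    using ig ia by (intro Bochner_Integration.integrable_minus) auto
  then obtain p where p: "W11_deriv T p (\<lambda>t. - transpose (mat_A P t) *v p t + - (g t + \<mu> *\<^sub>R con_a P t))" "p T = c"
    using linear_ivp_exists[OF A, of _ T c] T_pos by auto
  have "(\<lambda>t. - transpose (mat_A P t) *v p t + - (g t + \<mu> *\<^sub>R con_a P t))
      = (\<lambda>t. - (p t v* mat_A P t) - (g t + \<mu> *\<^sub>R con_a P t))"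
    by (simp add: bounded_bilinear.minus_left[OF bounded_bilinear_matrix_vector_mult] fun_eq_iff)
  with p show thesis by (intro that[of p]) simp_all
qed

text \<open>The payoff increment is split through the intermediate value
  \<open>f t (x u t) (w n t)\<close>: the state part is differentiated, while concavity bounds the
  control part from below. Optimality of \<open>u\<close> is then divided by
  \<open>step n\<close>.\<close>

lemma lagrangian_variation:
  assumes u: "u \<in> controls P" and v: "v \<in> controls P"
    and max: "\<And>w. w \<in> controls P \<Longrightarrow> payoff P w + \<mu> * constraint P w \<le> payoff P u + \<mu> * constraint P u"
    and lim: "(\<lambda>n. LINT t|M. (f t (x u t + step n *\<^sub>R (x v t - x u t)) (u t + step n *\<^sub>R (v t - u t))
          - f t (x u t) (u t + step n *\<^sub>R (v t - u t))) / step n) \<longlonglongrightarrow> D"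
    and end_deriv: "GDERIV \<phi> (x u T) :> g"
  shows "D + (LINT t|M. f t (x u t) (v t) - f t (x u t) (u t)) + (x v T - x u T) \<bullet> g
      + \<mu> * (constraint P v - constraint P u) \<le> 0"
proof -
  define w where "w n t = u t + step n *\<^sub>R (v t - u t)" for n t
  define z where "z n t = x u t + step n *\<^sub>R (x v t - x u t)" for n t
  define q where "q n t = (f t (z n t) (w n t) - f t (x u t) (w n t)) / step n" for n t
  define r where "r n = (\<phi> (x u T + step n *\<^sub>R (x v T - x u T)) - \<phi> (x u T)) / step n" for n
  note step01 = less_imp_le[OF step(1)] step(2)
  have xu: "continuous_on {0..T} (x u)" and xv: "continuous_on {0..T} (x v)"
    using u v by (auto intro: state_continuous)
  have z_cont: "continuous_on {0..T} (z n)" for n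
    unfolding z_def using xu xv by (intro continuous_intros)
  have wc: "w n \<in> controls P" for n
    unfolding w_def by (rule controls_segment[OF u v step01])
  have z: "x (w n) t = z n t" if "t \<in> {0..T}" for n t
    unfolding w_def z_def using that by (rule state_segment[OF u v step01])
  have i1: "integrable M (\<lambda>t. f t (z n t) (w n t))" for n by (rule run_payoff_integrable[OF z_cont wc])
  have i2: "integrable M (\<lambda>t. f t (x u t) (w n t))" for n by (rule run_payoff_integrable[OF xu wc])
  have i3: "integrable M (\<lambda>t. f t (x u t) (v t))" by (rule run_payoff_integrable[OF xu v])
  have i4: "integrable M (\<lambda>t. f t (x u t) (u t))" by (rule run_payoff_integrable[OF xu u])
  have le: "integral\<^sup>L M (q n) + (LINT t|M. f t (x u t) (v t) - f t (x u t) (u t)) + r n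
      + \<mu> * (constraint P v - constraint P u) \<le> 0" for n
  proof -
    have payoff_w: "payoff P (w n) = (LINT t|M. f t (z n t) (w n t)) + \<phi> (z n T)"
      unfolding payoff_def using integral_time_cong[of "\<lambda>t. f t (x (w n) t) (w n t)" "\<lambda>t. f t (z n t) (w n t)"]
        z T_pos by simp
    \<comment> \<open>At the fixed state \<open>x u t\<close>, concavity in the control makes the
      increment at least \<open>step n\<close> times the full one.\<close>
    have "(LINT t|M. f t (x u t) (u t) + step n * (f t (x u t) (v t) - f t (x u t) (u t)))
        \<le> (LINT t|M. f t (x u t) (w n t))"
    proof (rule integral_mono_AE)
      show "AE t in M. f t (x u t) (u t) + step n * (f t (x u t) (v t) - f t (x u t) (u t))
          \<le> f t (x u t) (w n t)"
        using f_AE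
      proof eventually_elim
        case (elim t)
        show ?case
          using concave_on_UNIV_segment[OF conjunct2[OF elim] step01[of n], of "(x u t, u t)" "(x u t, v t)"]
          by (simp add: w_def algebra_simps)
      qed
    qed (use i2 i3 i4 in auto)
    then have A: "step n * (LINT t|M. f t (x u t) (v t) - f t (x u t) (u t))
        \<le> (LINT t|M. f t (x u t) (w n t)) - (LINT t|M. f t (x u t) (u t))"
      using i3 i4 by simp
    have B: "step n * integral\<^sup>L M (q n) = (LINT t|M. f t (z n t) (w n t)) - (LINT t|M. f t (x u t) (w n t))"
      unfolding q_def using i1[of n] i2[of n] step(1)[of n] by simp
    have C: "step n * r n = \<phi> (z n T) - \<phi> (x u T)"
      unfolding r_def z_def using step(1)[of n] by simp
    \<comment> \<open>The constraint is exactly affine along the segment, so its quotient is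
      constant in \<open>n\<close>.\<close>
    have D: "constraint P (w n) = constraint P u + step n * (constraint P v - constraint P u)"
      unfolding w_def by (rule constraint_segment[OF u v step01])
    have "payoff P (w n) + \<mu> * constraint P (w n) \<le> payoff P u + \<mu> * constraint P u"
      by (rule max[OF wc])
    then have "payoff P (w n) + \<mu> * (step n * (constraint P v - constraint P u)) \<le> payoff P u"
      unfolding D by (simp add: distrib_left)
    then have "step n * (integral\<^sup>L M (q n) + (LINT t|M. f t (x u t) (v t) - f t (x u t) (u t)) + r n
        + \<mu> * (constraint P v - constraint P u)) \<le> 0"
      unfolding distrib_left B C using A payoff_w by (simp add: payoff_def mult.left_commute)
    then show ?thesis using step(1)[of n] by (simp add: mult_le_0_iff)
  qed
  have "(\<lambda>n. integral\<^sup>L M (q n)) \<longlonglongrightarrow> D"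
    using lim unfolding q_def z_def w_def .
  moreover have "r \<longlonglongrightarrow> (x v T - x u T) \<bullet> g"
  proof -
    have "filterlim step (at 0) sequentially"
      using step(3) step(1) by (auto simp: filterlim_at less_imp_neq[symmetric])
    then show ?thesis
      unfolding r_def by (rule filterlim_compose[OF GDERIV_imp_directional_limit[OF end_deriv]])
  qed
  ultimately have "(\<lambda>n. integral\<^sup>L M (q n) + (LINT t|M. f t (x u t) (v t) - f t (x u t) (u t)) + r n
      + \<mu> * (constraint P v - constraint P u))
    \<longlonglongrightarrow> D + (LINT t|M. f t (x u t) (v t) - f t (x u t) (u t)) + (x v T - x u T) \<bullet> g
      + \<mu> * (constraint P v - constraint P u)"
    by (intro tendsto_intros)
  then show ?thesis
    by (rule LIMSEQ_le_const2) (use le in blast)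
qed

lemma hamiltonian_continuous:
  assumes "continuous_on UNIV (\<lambda>(y, v). f t y v)"
  shows "continuous_on UNIV (\<lambda>v. hamiltonian P t y v p \<mu>)"
proof -
  have "continuous_on UNIV (\<lambda>v. (\<lambda>(y, v). f t y v) (y, v))"
    by (rule continuous_on_compose2[OF assms]) (auto intro!: continuous_intros)
  then show ?thesis
    unfolding hamiltonian_eq by (intro continuous_intros) simp
qed

text \<open>Testing the integrated inequality with controls that switch to a constant value wherever this
  increases the Hamiltonian makes it pointwise.\<close>

lemma integral_hamiltonian_le_imp_maximum:
  assumes u: "u \<in> controls P" and y: "continuous_on {0..T} y"
    and int: "\<And>v. v \<in> controls P \<Longrightarrow> integrable M
      (\<lambda>t. hamiltonian P t (y t) (v t) (p t) \<mu> - hamiltonian P t (y t) (u t) (p t) \<mu>)"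
    and le: "\<And>v. v \<in> controls P \<Longrightarrow>
      (LINT t|M. hamiltonian P t (y t) (v t) (p t) \<mu> - hamiltonian P t (y t) (u t) (p t) \<mu>) \<le> 0"
  shows "AE t in M. is_arg_max (\<lambda>v. hamiltonian P t (y t) v (p t) \<mu>) (\<lambda>v. v \<in> U) (u t)"
proof -
  let ?H = "\<lambda>t v. hamiltonian P t (y t) v (p t) \<mu>"
  have const: "AE t in M. ?H t c \<le> ?H t (u t)" if c: "c \<in> U" for c
  proof -
    define E where "E t = ?H t c - ?H t (u t)" for t
    have cc: "(\<lambda>_. c) \<in> controls P" using c by (intro controlsI) auto
    have E: "integrable M E" unfolding E_def by (rule int[OF cc])
    then have [measurable]: "E \<in> borel_measurable M" by auto
    have [measurable]: "u \<in> borel_measurable M" by (rule controls_measurable[OF u])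
    \<comment> \<open>Switching to \<open>c\<close> exactly where it is better turns the integrand
      into the positive part of \<open>E\<close>, whose integral is then both nonnegative and
      nonpositive.\<close>
    define v where "v t = (if E t > 0 then c else u t)" for t
    have v: "v \<in> controls P"
    proof (rule controlsI)
      show "v \<in> borel_measurable M" unfolding v_def by measurable
      show "AE t in M. v t \<in> U"
        using controls_AE[OF u] by eventually_elim (simp add: v_def c)
    qed
    have eq: "?H t (v t) - ?H t (u t) = max 0 (E t)" for t
      by (simp add: v_def E_def max_def)
    have "(LINT t|M. max 0 (E t)) \<le> 0" and i: "integrable M (\<lambda>t. max 0 (E t))"
      using le[OF v] int[OF v] by (simp_all add: eq)
    then have "(LINT t|M. max 0 (E t)) = 0"
      by (intro antisym integral_nonneg_AE) auto
    then have "AE t in M. max 0 (E t) = 0"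
      using i by (subst (asm) integral_nonneg_eq_0_iff_AE) auto
    then show ?thesis by eventually_elim (simp add: E_def max_def split: if_splits)
  qed
  \<comment> \<open>The exceptional null set in \<open>const\<close> depends on \<open>c\<close>. A
    countable dense subset of \<open>U\<close> gives a common one, and continuity of the Hamiltonian
    in the control extends the bound to \<open>U\<close>.\<close>
  obtain D where D: "countable D" "D \<subseteq> U" "U \<subseteq> closure D"
    using separable by blast
  have "AE t in M. \<forall>c\<in>D. ?H t c \<le> ?H t (u t)"
    using D const by (subst AE_ball_countable) auto
  then show ?thesis
    using f_AE controls_AE[OF u]
  proof eventually_elim
    case (elim t)
    have "continuous_on UNIV (?H t)"
      using elim(2) by (intro hamiltonian_continuous C1_fun_continuous_on) auto
    then have "closed {v. ?H t v \<le> ?H t (u t)}"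
      by (intro closed_Collect_le continuous_on_const)
    moreover have "D \<subseteq> {v. ?H t v \<le> ?H t (u t)}" using elim(1) by auto
    ultimately have "closure D \<subseteq> {v. ?H t v \<le> ?H t (u t)}" by (intro closure_minimal)
    with D(3) elim(3) show ?case
      by (auto simp: is_arg_max_linorder)
  qed
qed

text \<open>The adjoint state converts the effect of the changed trajectory into terms at the fixed
  state \<open>x u\<close>: the integrated Hamiltonian increment equals the bound from the first
  variation, which is nonpositive.\<close>

lemma maximizes_lagrangian_imp_pontryagin:
  assumes u: "u \<in> controls P"
    and max: "\<And>w. w \<in> controls P \<Longrightarrow> payoff P w + \<mu> * constraint P w \<le> payoff P u + \<mu> * constraint P u"
  shows "pontryagin_multiplier P u \<mu>"
proof -
  have xu: "continuous_on {0..T} (x u)" by (rule state_continuous[OF u])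
  obtain g where g: "g \<in> borel_measurable M" "\<exists>K. AE t in M. norm (g t) \<le> K"
    and g_deriv: "AE t in M. GDERIV (\<lambda>z. f t z (u t)) (x u t) :> g t"
    and g_lim: "\<forall>v\<in>controls P. \<forall>d. continuous_on {0..T} d \<longrightarrow>
      (\<lambda>n. LINT t|M. (f t (x u t + step n *\<^sub>R d t) (u t + step n *\<^sub>R (v t - u t))
          - f t (x u t) (u t + step n *\<^sub>R (v t - u t))) / step n)
        \<longlonglongrightarrow> (LINT t|M. d t \<bullet> g t)"
    and g_int: "\<forall>d. continuous_on {0..T} d \<longrightarrow> integrable M (\<lambda>t. d t \<bullet> g t)"
    by (rule partial_gradient[OF xu u])
  obtain c where c: "GDERIV \<phi> (x u T) :> c" using end_GDERIV by blast
  define dp where "dp p t = - (p t v* mat_A P t) - (g t + \<mu> *\<^sub>R con_a P t)" for p t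
  obtain p where p: "W11_deriv T p (dp p)" and pT: "p T = c"
    using adjoint_exists[OF g, of \<mu> c] unfolding dp_def[abs_def] by blast
  have key: "has_bochner_integral M
      (\<lambda>t. hamiltonian P t (x u t) (v t) (p t) \<mu> - hamiltonian P t (x u t) (u t) (p t) \<mu>)
      ((LINT t|M. (x v t - x u t) \<bullet> g t) + (LINT t|M. f t (x u t) (v t) - f t (x u t) (u t))
        + (x v T - x u T) \<bullet> c + \<mu> * (constraint P v - constraint P u))" (is "has_bochner_integral M ?h _")
    if v: "v \<in> controls P" for v
  proof -
    define d where "d t = x v t - x u t" for t
    define dd where "dd t = mat_A P t *v (x v t - x u t) + mat_B P t *v (v t - u t)" for t
    have d: "W11_deriv T d dd"
      unfolding d_def dd_def by (rule state_diff_deriv[OF u v])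
    have d0: "d 0 = 0" using state_deriv(2)[OF u] state_deriv(2)[OF v] by (simp add: d_def)
    have "has_bochner_integral M (\<lambda>t. dp p t \<bullet> d t + p t \<bullet> dd t) (d T \<bullet> c)"
      using W11_deriv_inner[OF p d] T_pos d0 pT by (simp add: inner_commute)
    moreover have "has_bochner_integral M (\<lambda>t. d t \<bullet> g t) (LINT t|M. d t \<bullet> g t)"
      using g_int[rule_format, OF W11_deriv_continuous[OF d]] by (rule has_bochner_integral_integrable)
    moreover have "has_bochner_integral M (\<lambda>t. f t (x u t) (v t) - f t (x u t) (u t))
        (LINT t|M. f t (x u t) (v t) - f t (x u t) (u t))"
      using run_payoff_integrable[OF xu u] run_payoff_integrable[OF xu v]
      by (intro has_bochner_integral_integrable) simp
    moreover have "has_bochner_integral M (\<lambda>t. \<mu> * (con_h P t (x v t) (v t) - con_h P t (x u t) (u t)))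
        (\<mu> * (constraint P v - constraint P u))"
      using con_h_integrable[OF xu u] con_h_integrable[OF state_continuous[OF v] v]
      by (simp add: has_bochner_integral_iff constraint_def)
    ultimately have *: "has_bochner_integral M
        (\<lambda>t. d t \<bullet> g t + (f t (x u t) (v t) - f t (x u t) (u t)) + (dp p t \<bullet> d t + p t \<bullet> dd t)
          + \<mu> * (con_h P t (x v t) (v t) - con_h P t (x u t) (u t)))
      ((LINT t|M. d t \<bullet> g t) + (LINT t|M. f t (x u t) (v t) - f t (x u t) (u t))
        + d T \<bullet> c + \<mu> * (constraint P v - constraint P u))"
      by (intro has_bochner_integral_add)
    have "?h t = d t \<bullet> g t + (f t (x u t) (v t) - f t (x u t) (u t)) + (dp p t \<bullet> d t + p t \<bullet> dd t)
          + \<mu> * (con_h P t (x v t) (v t) - con_h P t (x u t) (u t))" for t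
    proof -
      \<comment> \<open>The adjoint and the state equation are dual: the \<open>mat_A\<close> terms
        cancel, leaving control terms and the gradients applied to \<open>d\<close>.\<close>
      have "(p t v* mat_A P t) \<bullet> d t = p t \<bullet> (mat_A P t *v d t)" by (rule dot_lmul_matrix)
      then have "dp p t \<bullet> d t + p t \<bullet> dd t
          = p t \<bullet> (mat_B P t *v v t) - p t \<bullet> (mat_B P t *v u t) - d t \<bullet> g t - \<mu> * (con_a P t \<bullet> d t)"
        by (simp add: dp_def dd_def d_def[symmetric] inner_diff_left inner_add_left inner_add_right
            matrix_vector_mult_diff_distrib inner_diff_right inner_commute)
      then show ?thesis
        by (simp add: hamiltonian_def con_h_def d_def inner_add_right inner_diff_right algebra_simps)
    qed
    with * show ?thesis unfolding d_def by (simp only:)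
  qed
  have key_le: "(LINT t|M. (x v t - x u t) \<bullet> g t) + (LINT t|M. f t (x u t) (v t) - f t (x u t) (u t))
      + (x v T - x u T) \<bullet> c + \<mu> * (constraint P v - constraint P u) \<le> 0" if v: "v \<in> controls P" for v
    using lagrangian_variation[OF u v max g_lim[rule_format, OF v] c] xu state_continuous[OF v]
    by (simp add: continuous_on_diff)
  have "AE t in M. is_arg_max (\<lambda>v. hamiltonian P t (x u t) v (p t) \<mu>) (\<lambda>v. v \<in> U) (u t)"
    by (rule integral_hamiltonian_le_imp_maximum[OF u xu])
      (use key key_le in \<open>simp_all add: has_bochner_integral_iff\<close>)
  then have "AE t in M. (GDERIV (\<lambda>z. hamiltonian P t z (u t) (p t) \<mu>) (x u t) :> - dp p t) \<and>
      is_arg_max (\<lambda>v. hamiltonian P t (x u t) v (p t) \<mu>) (\<lambda>v. v \<in> U) (u t)"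
    using g_deriv
  proof eventually_elim
    case (elim t)
    have "GDERIV (\<lambda>z. hamiltonian P t z (u t) (p t) \<mu>) (x u t) :>
        g t + (p t v* mat_A P t + \<mu> *\<^sub>R con_a P t) + 0 + 0"
      unfolding hamiltonian_eq by (intro GDERIV_add elim GDERIV_inner_const GDERIV_const)
    then show ?case using elim(1) by (simp add: dp_def algebra_simps)
  qed
  with p c pT show ?thesis unfolding pontryagin_multiplier_def by blast
qed

end

section \<open>Normality, and assembly of the three claims\<close>

theorem proposition3p14:
  fixes P :: "('n::finite, 'm::finite) control_problem"
    and B0 :: real
    and ustar :: "real \<Rightarrow> real^'m"
  assumes "structured_problem P"
    and "B0 \<in> interior (value_dom P)"
    and "optimal_control P B0 ustar"
  shows "((\<exists>\<mu>. fritz_john P B0 ustar 1 \<mu>) \<and>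
          (\<forall>l0 \<mu>. fritz_john P B0 ustar l0 \<mu> \<longrightarrow> l0 > 0 \<and> fritz_john P B0 ustar 1 (\<mu> / l0)))
       \<and> (\<forall>\<mu>. pontryagin_multiplier P ustar \<mu> \<longrightarrow>
            saddle_point P B0 ustar \<mu> \<and> \<mu> \<in> dual_optimal P B0)
       \<and> (\<forall>\<mu>\<in>dual_optimal P B0. \<exists>u. optimal_control P B0 u \<and> pontryagin_multiplier P u \<mu>)"
proof -
  interpret structured P by unfold_locales (rule assms(1))
  have u: "ustar \<in> controls P" "constraint P ustar = B0"
    using assms(3) by (auto simp: optimal_control_def)
  \<comment> \<open>\<open>ustar\<close> meets the constraint level, so the multiplier term vanishes
    on the right.\<close>
  have fj_iff: "fritz_john P B0 ustar l0 \<mu> \<longleftrightarrow> l0 \<ge> 0 \<and> (l0, \<mu>) \<noteq> (0, 0) \<and>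
      (\<forall>v\<in>controls P. l0 * payoff P v + \<mu> * (constraint P v - B0) \<le> l0 * payoff P ustar)" for l0 \<mu>
    using u by (auto simp: fritz_john_def is_arg_max_linorder)
  have normal: "l0 > 0 \<and> fritz_john P B0 ustar 1 (\<mu> / l0)" if fj: "fritz_john P B0 ustar l0 \<mu>" for l0 \<mu>
  proof
    show pos: "l0 > 0"
    proof (rule ccontr)
      assume "\<not> l0 > 0"
      with fj have \<mu>: "\<mu> \<noteq> 0" and le: "\<And>v. v \<in> controls P \<Longrightarrow> \<mu> * (constraint P v - B0) \<le> 0"
        by (auto simp: fj_iff)
      \<comment> \<open>With vanishing payoff coefficient, \<mu> times the constraint gap is
        nonpositive for controls on both sides of \<open>B0\<close>, which forces \<mu> to be
        0.\<close>
      obtain u1 u2 where "u1 \<in> controls P" "u2 \<in> controls P" "constraint P u1 < B0" "B0 < constraint P u2"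
        using interior_value_dom[OF assms(2)] by blast
      with le[of u1] le[of u2] \<mu> show False by (auto simp: mult_le_0_iff)
    qed
    have "payoff P v + \<mu> / l0 * (constraint P v - B0) \<le> payoff P ustar" if "v \<in> controls P" for v
    proof -
      have "l0 * (payoff P v + \<mu> / l0 * (constraint P v - B0)) \<le> l0 * payoff P ustar"
        using fj that pos by (simp add: fj_iff distrib_left)
      then show ?thesis using pos by simp
    qed
    then show "fritz_john P B0 ustar 1 (\<mu> / l0)" by (simp add: fj_iff)
  qed
  \<comment> \<open>A normal multiplier exists, so normality does not hold vacuously.\<close>
  obtain \<mu>\<^sub>0 where "\<And>v. v \<in> controls P \<Longrightarrow> payoff P v + \<mu>\<^sub>0 * (constraint P v - B0) \<le> payoff P ustar"
    using lagrange_multiplier_exists[OF assms(2,3)] by blast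
  then have "fritz_john P B0 ustar 1 \<mu>\<^sub>0" by (simp add: fj_iff)
  moreover have "saddle_point P B0 ustar \<mu> \<and> \<mu> \<in> dual_optimal P B0" if "pontryagin_multiplier P ustar \<mu>" for \<mu>
  proof -
    have "payoff P v + \<mu> * (constraint P v - B0) \<le> payoff P ustar" if "v \<in> controls P" for v
      using pontryagin_imp_maximizes_lagrangian[OF u(1) \<open>pontryagin_multiplier P ustar \<mu>\<close> that] u(2)
      by (simp add: algebra_simps)
    \<comment> \<open>As \<open>constraint P ustar = B0\<close>, the Lagrangian at
      \<open>ustar\<close> is constant in the multiplier, which gives the second saddle
      inequality.\<close>
    then show ?thesis
      using u dual_optimalI[OF u] by (simp add: saddle_point_def lagrangian_def)
  qed
  moreover have "pontryagin_multiplier P ustar \<mu>" if "\<mu> \<in> dual_optimal P B0" for \<mu>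
    using dual_optimalD[OF assms(2,3) that] u
    by (intro maximizes_lagrangian_imp_pontryagin) (auto simp: algebra_simps)
  ultimately show ?thesis using normal assms(3) by blast
qed

end
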